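(* Let $n\ge 2$. The virtual singular pure braid monoid $VSP_n$ has a presentation (as a monoid) with generators the generalized fusing strings $\{\mu_{kl},\mu_{kl}^{-1},\gamma_{kl}\mid 1\le k\neq l\le n\}$, subject to the following relations: \begin{align*} \mu_{kl}\mu_{kl}^{-1}&=\mu_{kl}^{-1}\mu_{kl}=1_n,\\ \mu_{ij}\mu_{ik}\mu_{jk}&=\mu_{jk}\mu_{ik}\mu_{ij},\\ \mu_{ij}\mu_{ik}\gamma_{jk}&=\gamma_{jk}\mu_{ik}\mu_{ij},\\ \gamma_{ij}\mu_{ik}\mu_{jk}&=\mu_{jk}\mu_{ik}\gamma_{ij},\\ \mu_{kl}\gamma_{lk}&=\gamma_{kl}\mu_{lk},\\ \mu_{ij}\mu_{kl}=\mu_{kl}\mu_{ij},\qquad \gamma_{ij}\gamma_{kl}&=\gamma_{kl}\gamma_{ij},\qquad \mu_{ij}\gamma_{kl}=\gamma_{kl}\mu_{ij}, \end{align*} where all indices lie in $\{1,\dots,n\}$ and, within each relation, distinct letters stand for distinct indices.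
   Context: $VSB_n$, the $n$-stranded virtual singular braid monoid, is the monoid, with identity $1_n$, presented by generators $\sigma_i,\sigma_i^{-1},v_i,\tau_i$ ($1\le i\le n-1$) and relations (indices range over all values in $\{1,\dots,n-1\}$ satisfying the indicated condition): (1) $\sigma_i\sigma_i^{-1}=\sigma_i^{-1}\sigma_i=1_n$; (2) $v_i^2=1_n$; (3) $\sigma_i\sigma_j\sigma_i=\sigma_j\sigma_i\sigma_j$ for $|i-j|=1$; (4) $v_iv_jv_i=v_jv_iv_j$ for $|i-j|=1$; (5) $v_i\sigma_jv_i=v_j\sigma_iv_j$ for $|i-j|=1$; (6) $v_i\tau_jv_i=v_j\tau_iv_j$ for $|i-j|=1$; (7) $\sigma_i\sigma_j\tau_i=\tau_j\sigma_i\sigma_j$ for $|i-j|=1$; (8) $\sigma_i\tau_i=\tau_i\sigma_i$; (9) $g_ih_j=h_jg_i$ for $|i-j|>1$, where $g_i\in\{\sigma_i,\tau_i,v_i\}$ and $h_j\in\{\sigma_j,\tau_j,v_j\}$. Let $S_n$ be the symmetric group on $n$ letters and let $\pi: VSB_n\to S_n$ be the monoid homomorphism sending each of $\sigma_i,\sigma_i^{-1},v_i,\tau_i$ to the transposition $(i\ \,i+1)$ (also denoted $v_i$). The virtual singular pure braid monoid is $VSP_n=\ker(\pi)=\{\beta\in VSB_n\mid \pi(\beta)=\mathrm{id}\}$. Set $\mu_i=\sigma_iv_i$, $\mu_i^{-1}=v_i\sigma_i^{-1}$, $\gamma_i=\tau_iv_i$ for $1\le i\le n-1$. The generalized fusing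 strings are the following elements of $VSP_n$, for $1\le i<j\le n$: $$\mu_{ij}=(v_{j-1}v_{j-2}\cdots v_{i+1})\,\mu_i\,(v_{i+1}\cdots v_{j-2}v_{j-1}),\qquad \gamma_{ij}=(v_{j-1}v_{j-2}\cdots v_{i+1})\,\gamma_i\,(v_{i+1}\cdots v_{j-2}v_{j-1}),$$ $$\mu_{ji}=(v_{j-1}v_{j-2}\cdots v_{i+1})\,v_i\mu_iv_i\,(v_{i+1}\cdots v_{j-2}v_{j-1}),\qquad \gamma_{ji}=(v_{j-1}v_{j-2}\cdots v_{i+1})\,v_i\gamma_iv_i\,(v_{i+1}\cdots v_{j-2}v_{j-1}).$$ $\mu_{kl}^{-1}$ denotes the inverse of $\mu_{kl}$ in $VSB_n$. *)

theory Defs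
  imports "HOL-Algebra.Sym_Groups"
begin

section \<open>Monoid presentations\<close>

text \<open>The free monoid on A is \<^term>\<open>lists A\<close> with concatenation; a relation u = v is the pair (u, v).
  The following is the least congruence on \<^term>\<open>lists A\<close> containing the relations.\<close>

inductive_set word_cong :: "'a set \<Rightarrow> ('a list \<times> 'a list) set \<Rightarrow> ('a list \<times> 'a list) set"
  for A :: "'a set" and R :: "('a list \<times> 'a list) set"
where
  base: "\<lbrakk>(u, v) \<in> R; u \<in> lists A; v \<in> lists A; x \<in> lists A; y \<in> lists A\<rbrakk>
          \<Longrightarrow> (x @ u @ y, x @ v @ y) \<in> word_cong A R"
| refl: "u \<in> lists A \<Longrightarrow> (u, u) \<in> word_cong A R"
| sym: "(u, v) \<in> word_cong A R \<Longrightarrow> (v, u) \<in> word_cong A R"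
| trans: "\<lbrakk>(u, v) \<in> word_cong A R; (v, w) \<in> word_cong A R\<rbrakk> \<Longrightarrow> (u, w) \<in> word_cong A R"

definition word_class :: "'a set \<Rightarrow> ('a list \<times> 'a list) set \<Rightarrow> 'a list \<Rightarrow> 'a list set" where
  "word_class A R w = word_cong A R `` {w}"

definition presented_monoid :: "'a set \<Rightarrow> ('a list \<times> 'a list) set \<Rightarrow> 'a list set monoid" where
  "presented_monoid A R =
     \<lparr> carrier = lists A // word_cong A R,
       mult = (\<lambda>X Y. \<Union>u\<in>X. \<Union>v\<in>Y. word_class A R (u @ v)),
       one = word_class A R [] \<rparr>"

text \<open>M is presented by the symbols A, where the symbol a names the element \<^term>\<open>g a\<close> of M,
  subject to the relations R.\<close>

definition has_presentation ::
    "('m, 'b) monoid_scheme \<Rightarrow> 'a set \<Rightarrow> ('a \<Rightarrow> 'm) \<Rightarrow> ('a list \<times> 'a list) set \<Rightarrow> bool" where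
  "has_presentation M A g R \<longleftrightarrow>
     monoid M \<and>
     (\<exists>\<phi> \<in> iso (presented_monoid A R) M. \<forall>a\<in>A. \<phi> (word_class A R [a]) = g a)"

definition word_val :: "('m, 'b) monoid_scheme \<Rightarrow> ('a \<Rightarrow> 'm) \<Rightarrow> 'a list \<Rightarrow> 'm" where
  "word_val M f w = foldr (\<lambda>a y. f a \<otimes>\<^bsub>M\<^esub> y) w \<one>\<^bsub>M\<^esub>"

text \<open>The homomorphism out of a presented monoid determined by the images f of the generators;
  it is meaningful when f respects the relations (lemma \<open>induced_hom\<close> below).\<close>

definition induced_map :: "('m, 'b) monoid_scheme \<Rightarrow> ('a \<Rightarrow> 'm) \<Rightarrow> 'a list set \<Rightarrow> 'm" where
  "induced_map M f X = the_elem (word_val M f ` X)"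

lemma word_cong_in_lists:
  "(u, v) \<in> word_cong A R \<Longrightarrow> u \<in> lists A \<and> v \<in> lists A"
  by (induction rule: word_cong.induct) auto

lemma word_cong_equiv: "equiv (lists A) (word_cong A R)"
proof (rule equivI)
  show "word_cong A R \<subseteq> lists A \<times> lists A"
    using word_cong_in_lists by fastforce
  show "refl_on (lists A) (word_cong A R)"
    by (auto simp: refl_on_def intro: word_cong.refl)
  show "sym (word_cong A R)"
    by (blast intro: symI word_cong.sym)
  show "trans (word_cong A R)"
    by (blast intro: transI word_cong.trans)
qed

lemma word_cong_context:
  assumes "(u, v) \<in> word_cong A R" "x \<in> lists A" "y \<in> lists A"
  shows "(x @ u @ y, x @ v @ y) \<in> word_cong A R"
  using assms
proof (induction rule: word_cong.induct)
  case (base u v x' y')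
  have "((x @ x') @ u @ (y' @ y), (x @ x') @ v @ (y' @ y)) \<in> word_cong A R"
    by (rule word_cong.base) (use base in auto)
  then show ?case by simp
next
  case (refl u)
  then show ?case by (intro word_cong.refl) simp
next
  case (sym u v)
  then show ?case by (auto intro: word_cong.sym)
next
  case (trans u v w)
  then show ?case by (meson word_cong.trans)
qed

lemma word_cong_append:
  assumes "(u, u') \<in> word_cong A R" "(v, v') \<in> word_cong A R"
  shows "(u @ v, u' @ v') \<in> word_cong A R"
proof -
  have "(u @ v, u' @ v) \<in> word_cong A R"
    using word_cong_context[OF assms(1), of "[]" v] word_cong_in_lists[OF assms(2)] by simp
  moreover have "(u' @ v, u' @ v') \<in> word_cong A R"
    using word_cong_context[OF assms(2), of u' "[]"] word_cong_in_lists[OF assms(1)] by simp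
  ultimately show ?thesis by (rule word_cong.trans)
qed

lemma word_class_eq_iff:
  assumes "u \<in> lists A" "v \<in> lists A"
  shows "word_class A R u = word_class A R v \<longleftrightarrow> (u, v) \<in> word_cong A R"
  unfolding word_class_def using eq_equiv_class_iff[OF word_cong_equiv assms] .

lemma carrier_presented_monoid:
  "carrier (presented_monoid A R) = word_class A R ` lists A"
  by (auto simp: presented_monoid_def quotient_def word_class_def)

lemma mult_word_class:
  assumes "u \<in> lists A" "v \<in> lists A"
  shows "word_class A R u \<otimes>\<^bsub>presented_monoid A R\<^esub> word_class A R v = word_class A R (u @ v)"
proof -
  have "word_class A R (u' @ v') = word_class A R (u @ v)"
    if "u' \<in> word_class A R u" "v' \<in> word_class A R v" for u' v'
  proof -
    have "(u @ v, u' @ v') \<in> word_cong A R"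
      using that by (auto simp: word_class_def intro: word_cong_append)
    then show ?thesis
      unfolding word_class_def using equiv_class_eq[OF word_cong_equiv] by blast
  qed
  moreover have "u \<in> word_class A R u" "v \<in> word_class A R v"
    using assms by (auto simp: word_class_def intro: word_cong.refl)
  ultimately have "(\<Union>u'\<in>word_class A R u. \<Union>v'\<in>word_class A R v. word_class A R (u' @ v')) =
      word_class A R (u @ v)" by blast
  then show ?thesis by (simp add: presented_monoid_def)
qed

lemma one_presented_monoid: "\<one>\<^bsub>presented_monoid A R\<^esub> = word_class A R []"
  by (simp add: presented_monoid_def)

lemma monoid_presented_monoid: "monoid (presented_monoid A R)"
proof (rule monoidI)
  show "\<one>\<^bsub>presented_monoid A R\<^esub> \<in> carrier (presented_monoid A R)"
    unfolding one_presented_monoid carrier_presented_monoid by blast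
next
  fix X Y
  assume "X \<in> carrier (presented_monoid A R)" "Y \<in> carrier (presented_monoid A R)"
  then obtain u v where "u \<in> lists A" "v \<in> lists A" "X = word_class A R u" "Y = word_class A R v"
    unfolding carrier_presented_monoid by blast
  then have "X \<otimes>\<^bsub>presented_monoid A R\<^esub> Y = word_class A R (u @ v)" "u @ v \<in> lists A"
    by (simp_all add: mult_word_class)
  then show "X \<otimes>\<^bsub>presented_monoid A R\<^esub> Y \<in> carrier (presented_monoid A R)"
    unfolding carrier_presented_monoid by blast
next
  fix X Y Z
  assume "X \<in> carrier (presented_monoid A R)" "Y \<in> carrier (presented_monoid A R)"
    "Z \<in> carrier (presented_monoid A R)"
  then obtain u v w where uvw: "u \<in> lists A" "v \<in> lists A" "w \<in> lists A"
    "X = word_class A R u" "Y = word_class A R v" "Z = word_class A R w"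
    unfolding carrier_presented_monoid by blast
  have "u @ v \<in> lists A" "v @ w \<in> lists A" using uvw by auto
  with uvw show "X \<otimes>\<^bsub>presented_monoid A R\<^esub> Y \<otimes>\<^bsub>presented_monoid A R\<^esub> Z =
      X \<otimes>\<^bsub>presented_monoid A R\<^esub> (Y \<otimes>\<^bsub>presented_monoid A R\<^esub> Z)"
    by (simp only: mult_word_class append_assoc)
next
  fix X
  assume "X \<in> carrier (presented_monoid A R)"
  then obtain u where "u \<in> lists A" "X = word_class A R u"
    unfolding carrier_presented_monoid by blast
  then show "\<one>\<^bsub>presented_monoid A R\<^esub> \<otimes>\<^bsub>presented_monoid A R\<^esub> X = X"
    and "X \<otimes>\<^bsub>presented_monoid A R\<^esub> \<one>\<^bsub>presented_monoid A R\<^esub> = X"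
    unfolding one_presented_monoid by (simp_all add: mult_word_class)
qed

context monoid
begin

lemma word_val_closed:
  "f \<in> A \<rightarrow> carrier G \<Longrightarrow> w \<in> lists A \<Longrightarrow> word_val G f w \<in> carrier G"
  by (induction w) (auto simp: word_val_def)

lemma word_val_append:
  "f \<in> A \<rightarrow> carrier G \<Longrightarrow> u \<in> lists A \<Longrightarrow> v \<in> lists A \<Longrightarrow>
   word_val G f (u @ v) = word_val G f u \<otimes> word_val G f v"
proof (induction u)
  case Nil
  then show ?case using word_val_closed[of f A v] by (simp add: word_val_def)
next
  case (Cons a u)
  have "f a \<in> carrier G" "word_val G f u \<in> carrier G" "word_val G f v \<in> carrier G"
    using Cons.prems word_val_closed[of f A] by auto
  moreover have "word_val G f (u @ v) = word_val G f u \<otimes> word_val G f v"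
    using Cons by auto
  moreover have "word_val G f (a # w) = f a \<otimes> word_val G f w" for w
    by (simp add: word_val_def)
  ultimately show ?case by (simp add: m_assoc)
qed

lemma word_val_cong:
  assumes f: "f \<in> A \<rightarrow> carrier G"
    and R: "\<forall>(u, v)\<in>R. word_val G f u = word_val G f v"
  shows "(u, v) \<in> word_cong A R \<Longrightarrow> word_val G f u = word_val G f v"
proof (induction rule: word_cong.induct)
  case (base u v x y)
  have "u @ y \<in> lists A" "v @ y \<in> lists A" using base by auto
  moreover have "word_val G f u = word_val G f v" using R base(1) by blast
  ultimately show ?case using base by (simp only: word_val_append[OF f])
qed simp_all

lemma induced_map_class:
  assumes f: "f \<in> A \<rightarrow> carrier G"
    and R: "\<forall>(u, v)\<in>R. word_val G f u = word_val G f v"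
    and u: "u \<in> lists A"
  shows "induced_map G f (word_class A R u) = word_val G f u"
proof -
  have "u \<in> word_class A R u"
    using u by (auto simp: word_class_def intro: word_cong.refl)
  moreover have "word_val G f v = word_val G f u" if "v \<in> word_class A R u" for v
    using word_val_cong[OF f R] that unfolding word_class_def by (metis Image_singleton_iff)
  ultimately have "word_val G f ` word_class A R u = {word_val G f u}" by blast
  then show ?thesis by (simp add: induced_map_def)
qed

lemma induced_hom:
  assumes f: "f \<in> A \<rightarrow> carrier G"
    and R: "\<forall>(u, v)\<in>R. word_val G f u = word_val G f v"
  shows "induced_map G f \<in> hom (presented_monoid A R) G"
    and "a \<in> A \<Longrightarrow> induced_map G f (word_class A R [a]) = f a"
    and "induced_map G f \<one>\<^bsub>presented_monoid A R\<^esub> = \<one>"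
proof -
  show "induced_map G f \<in> hom (presented_monoid A R) G"
  proof (rule homI)
    fix X assume "X \<in> carrier (presented_monoid A R)"
    then obtain u where "u \<in> lists A" "X = word_class A R u"
      unfolding carrier_presented_monoid by blast
    then show "induced_map G f X \<in> carrier G"
      using induced_map_class[OF f R] word_val_closed[OF f] by auto
  next
    fix X Y
    assume "X \<in> carrier (presented_monoid A R)" "Y \<in> carrier (presented_monoid A R)"
    then obtain u v where uv: "u \<in> lists A" "v \<in> lists A"
      "X = word_class A R u" "Y = word_class A R v"
      unfolding carrier_presented_monoid by blast
    moreover have "u @ v \<in> lists A" using uv by auto
    ultimately show "induced_map G f (X \<otimes>\<^bsub>presented_monoid A R\<^esub> Y) =
        induced_map G f X \<otimes> induced_map G f Y"
      using induced_map_class[OF f R] word_val_append[OF f] mult_word_class by metis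
  qed
  show "induced_map G f (word_class A R [a]) = f a" if "a \<in> A"
  proof -
    have "f a \<in> carrier G" using f that by auto
    then show ?thesis using induced_map_class[OF f R, of "[a]"] that
      by (simp add: word_val_def)
  qed
  show "induced_map G f \<one>\<^bsub>presented_monoid A R\<^esub> = \<one>"
    using induced_map_class[OF f R, of "[]"] by (simp add: one_presented_monoid word_val_def)
qed

end


section \<open>The virtual singular braid monoid\<close>

datatype vsb_gen = Sig nat | SigInv nat | Virt nat | Tau nat

definition vsb_gens :: "nat \<Rightarrow> vsb_gen set" where
  "vsb_gens n = (\<Union>i\<in>{1..<n}. {Sig i, SigInv i, Virt i, Tau i})"

definition vsb_rels :: "nat \<Rightarrow> (vsb_gen list \<times> vsb_gen list) set" where
  "vsb_rels n =
     {([Sig i, SigInv i], []) | i. i \<in> {1..<n}}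
   \<union> {([SigInv i, Sig i], []) | i. i \<in> {1..<n}}
   \<union> {([Virt i, Virt i], []) | i. i \<in> {1..<n}}
   \<union> {([Sig i, Sig j, Sig i], [Sig j, Sig i, Sig j]) | i j.
        i \<in> {1..<n} \<and> j \<in> {1..<n} \<and> \<bar>int i - int j\<bar> = 1}
   \<union> {([Virt i, Virt j, Virt i], [Virt j, Virt i, Virt j]) | i j.
        i \<in> {1..<n} \<and> j \<in> {1..<n} \<and> \<bar>int i - int j\<bar> = 1}
   \<union> {([Virt i, Sig j, Virt i], [Virt j, Sig i, Virt j]) | i j.
        i \<in> {1..<n} \<and> j \<in> {1..<n} \<and> \<bar>int i - int j\<bar> = 1}
   \<union> {([Virt i, Tau j, Virt i], [Virt j, Tau i, Virt j]) | i j.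
        i \<in> {1..<n} \<and> j \<in> {1..<n} \<and> \<bar>int i - int j\<bar> = 1}
   \<union> {([Sig i, Sig j, Tau i], [Tau j, Sig i, Sig j]) | i j.
        i \<in> {1..<n} \<and> j \<in> {1..<n} \<and> \<bar>int i - int j\<bar> = 1}
   \<union> {([Sig i, Tau i], [Tau i, Sig i]) | i. i \<in> {1..<n}}
   \<union> {([g i, h j], [h j, g i]) | g h i j.
        g \<in> {Sig, Tau, Virt} \<and> h \<in> {Sig, Tau, Virt} \<and>
        i \<in> {1..<n} \<and> j \<in> {1..<n} \<and> \<bar>int i - int j\<bar> > 1}"

definition VSB :: "nat \<Rightarrow> vsb_gen list set monoid" where
  "VSB n = presented_monoid (vsb_gens n) (vsb_rels n)"

definition vsb_class :: "nat \<Rightarrow> vsb_gen list \<Rightarrow> vsb_gen list set" where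
  "vsb_class n w = word_class (vsb_gens n) (vsb_rels n) w"

fun gen_perm :: "vsb_gen \<Rightarrow> nat \<Rightarrow> nat" where
  "gen_perm (Sig i) = transpose i (i + 1)"
| "gen_perm (SigInv i) = transpose i (i + 1)"
| "gen_perm (Virt i) = transpose i (i + 1)"
| "gen_perm (Tau i) = transpose i (i + 1)"

definition vsb_perm :: "nat \<Rightarrow> vsb_gen list set \<Rightarrow> nat \<Rightarrow> nat" where
  "vsb_perm n = induced_map (sym_group n) gen_perm"

definition VSP :: "nat \<Rightarrow> vsb_gen list set monoid" where
  "VSP n = (VSB n)\<lparr>carrier := kernel (VSB n) (sym_group n) (vsb_perm n)\<rparr>"

lemma gen_perm_in_sym_group: "gen_perm \<in> vsb_gens n \<rightarrow> carrier (sym_group n)"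
  by (auto simp: vsb_gens_def sym_group_carrier intro!: permutes_swap_id)

lemma transpose_braid:
  assumes "\<bar>int i - int j\<bar> = 1"
  shows "transpose i (Suc i) \<circ> (transpose j (Suc j) \<circ> transpose i (Suc i)) =
         transpose j (Suc j) \<circ> (transpose i (Suc i) \<circ> transpose j (Suc j))"
proof -
  consider "j = Suc i" | "i = Suc j" using assms by linarith
  then show ?thesis
    by cases (simp_all add: fun_eq_iff transpose_def)
qed

lemma transpose_far_commute:
  assumes "\<bar>int i - int j\<bar> > 1"
  shows "transpose i (Suc i) \<circ> transpose j (Suc j) = transpose j (Suc j) \<circ> transpose i (Suc i)"
  by (rule swap_id_independent) (use assms in auto)

lemma gen_perm_respects_rels:
  "\<forall>(u, v)\<in>vsb_rels n. word_val (sym_group n) gen_perm u = word_val (sym_group n) gen_perm v"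
proof clarify
  fix u v
  assume uv: "(u, v) \<in> vsb_rels n"
  have "gen_perm (g i) = transpose i (Suc i)" if "g \<in> {Sig, Tau, Virt}" for g i
    using that by auto
  with uv show "word_val (sym_group n) gen_perm u = word_val (sym_group n) gen_perm v"
    unfolding vsb_rels_def word_val_def sym_group_mult sym_group_one
    by (elim UnE CollectE exE conjE)
       (simp_all add: transpose_braid transpose_far_commute)
qed

lemma vsb_perm_hom: "vsb_perm n \<in> hom (VSB n) (sym_group n)"
  and vsb_perm_gen: "a \<in> vsb_gens n \<Longrightarrow> vsb_perm n (vsb_class n [a]) = gen_perm a"
  and vsb_perm_one: "vsb_perm n \<one>\<^bsub>VSB n\<^esub> = \<one>\<^bsub>sym_group n\<^esub>"
proof -
  interpret S: group "sym_group n" by (rule sym_group_is_group)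
  show "vsb_perm n \<in> hom (VSB n) (sym_group n)"
    and "a \<in> vsb_gens n \<Longrightarrow> vsb_perm n (vsb_class n [a]) = gen_perm a"
    and "vsb_perm n \<one>\<^bsub>VSB n\<^esub> = \<one>\<^bsub>sym_group n\<^esub>"
    unfolding vsb_perm_def VSB_def vsb_class_def
    using S.induced_hom[OF gen_perm_in_sym_group gen_perm_respects_rels] by auto
qed


section \<open>Generalized fusing strings\<close>

text \<open>For i < j, the word c is placed between \<open>v\<^sub>j\<^sub>-\<^sub>1 \<dots> v\<^sub>i\<^sub>+\<^sub>1\<close> and its reverse.\<close>

definition detour :: "nat \<Rightarrow> nat \<Rightarrow> vsb_gen list \<Rightarrow> vsb_gen list" where
  "detour i j c = map Virt (rev [i+1..<j]) @ c @ map Virt [i+1..<j]"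

definition mu_word :: "nat \<Rightarrow> vsb_gen list" where
  "mu_word i = [Sig i, Virt i]"

definition gamma_word :: "nat \<Rightarrow> vsb_gen list" where
  "gamma_word i = [Tau i, Virt i]"

definition mu :: "nat \<Rightarrow> nat \<Rightarrow> nat \<Rightarrow> vsb_gen list set" where
  "mu n k l = vsb_class n
     (if k < l then detour k l (mu_word k)
      else detour l k ([Virt l] @ mu_word l @ [Virt l]))"

definition gamma :: "nat \<Rightarrow> nat \<Rightarrow> nat \<Rightarrow> vsb_gen list set" where
  "gamma n k l = vsb_class n
     (if k < l then detour k l (gamma_word k)
      else detour l k ([Virt l] @ gamma_word l @ [Virt l]))"

datatype fuse_gen = Mu nat nat | MuInv nat nat | Gam nat nat

definition fuse_gens :: "nat \<Rightarrow> fuse_gen set" where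
  "fuse_gens n = {x. \<exists>k\<in>{1..n}. \<exists>l\<in>{1..n}. k \<noteq> l \<and> x \<in> {Mu k l, MuInv k l, Gam k l}}"

fun fuse_elem :: "nat \<Rightarrow> fuse_gen \<Rightarrow> vsb_gen list set" where
  "fuse_elem n (Mu k l) = mu n k l"
| "fuse_elem n (MuInv k l) = inv\<^bsub>VSB n\<^esub> (mu n k l)"
| "fuse_elem n (Gam k l) = gamma n k l"

definition fuse_rels :: "nat \<Rightarrow> (fuse_gen list \<times> fuse_gen list) set" where
  "fuse_rels n =
     {([Mu k l, MuInv k l], []) | k l. {k, l} \<subseteq> {1..n} \<and> distinct [k, l]}
   \<union> {([MuInv k l, Mu k l], []) | k l. {k, l} \<subseteq> {1..n} \<and> distinct [k, l]}
   \<union> {([Mu i j, Mu i k, Mu j k], [Mu j k, Mu i k, Mu i j]) | i j k.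
        {i, j, k} \<subseteq> {1..n} \<and> distinct [i, j, k]}
   \<union> {([Mu i j, Mu i k, Gam j k], [Gam j k, Mu i k, Mu i j]) | i j k.
        {i, j, k} \<subseteq> {1..n} \<and> distinct [i, j, k]}
   \<union> {([Gam i j, Mu i k, Mu j k], [Mu j k, Mu i k, Gam i j]) | i j k.
        {i, j, k} \<subseteq> {1..n} \<and> distinct [i, j, k]}
   \<union> {([Mu k l, Gam l k], [Gam k l, Mu l k]) | k l. {k, l} \<subseteq> {1..n} \<and> distinct [k, l]}
   \<union> {([Mu i j, Mu k l], [Mu k l, Mu i j]) | i j k l.
        {i, j, k, l} \<subseteq> {1..n} \<and> distinct [i, j, k, l]}
   \<union> {([Gam i j, Gam k l], [Gam k l, Gam i j]) | i j k l.
        {i, j, k, l} \<subseteq> {1..n} \<and> distinct [i, j, k, l]}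
   \<union> {([Mu i j, Gam k l], [Gam k l, Mu i j]) | i j k l.
        {i, j, k, l} \<subseteq> {1..n} \<and> distinct [i, j, k, l]}"

end

theory Submission
  imports Defs
begin

text \<open>The proof is a Reidemeister-Schreier argument for the kernel of \<open>\<pi>\<close>, with the words in the
  \<open>v\<^sub>i\<close> as transversal. Reading a braid word from left to right and writing each
  generator as \<open>\<sigma>\<^sub>i = \<mu>\<^sub>i v\<^sub>i\<close>, \<open>\<sigma>\<^sub>i\<^sup>-\<^sup>1 = (v\<^sub>i \<mu>\<^sub>i v\<^sub>i)\<^sup>-\<^sup>1 v\<^sub>i\<close>, \<open>\<tau>\<^sub>i = \<gamma>\<^sub>i v\<^sub>i\<close>,
  one pushes every \<open>v\<^sub>i\<close> to the right. Conjugation by \<open>v\<^sub>m\<close> permutes the fusing strings through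
  the transposition of m and m + 1 acting on their two indices (\<open>conj_strand\<close>), so a braid word w
  with the permutation p in front of it turns into a word \<open>rewrite p w\<close> in fusing strings followed
  by a word in the \<open>v\<^sub>i\<close> (\<open>rewrite_normal_form\<close>). The function \<open>rewrite\<close> works on words alone: a
  \<open>\<sigma>\<^sub>i\<close> met while the current permutation is p contributes \<open>\<mu>\<^bsub>p(i) p(i+1)\<^esub>\<close>, and so on.

  The transversal is faithful: words in the \<open>v\<^sub>i\<close> with the same permutation are equal in
  \<open>VSB\<^sub>n\<close> (\<open>virt_word_eq\<close>), because the \<open>v\<^sub>i\<close> satisfy the Coxeter relations of the symmetric group.
  Hence a pure braid word w equals \<open>rewrite id w\<close>, and the fusing strings generate
  (\<open>pure_word_is_fuse_word\<close>).

  The two sets of relations correspond under \<open>rewrite\<close>. If \<open>u = w\<close> in \<open>VSB\<^sub>n\<close>, cancelling the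
  transversal parts of the normal forms gives \<open>rewrite p u = rewrite p w\<close> in \<open>VSB\<^sub>n\<close>. Every fusing
  relation is \<open>rewrite p\<close> of a braid relation, with p sending 1, 2, ... to the given indices, and so
  it holds in \<open>VSP\<^sub>n\<close> (\<open>fuse_relation_holds\<close>). Conversely, \<open>rewrite p\<close> of any braid relation is a
  consequence of the fusing relations (\<open>rewrite_respects_relation\<close>). Therefore \<open>rewrite id\<close> is well
  defined on classes; since it returns a word in the fusing letters unchanged when these are spelled
  out as braid words (\<open>rewrite_fuse_word\<close>), no further relations hold.\<close>


section \<open>Classes of words\<close>

text \<open>A list with a letter outside A has the empty class, so the following congruence rules hold
  for all lists; this keeps side conditions out of the calculations with words below.\<close>

lemma word_class_outside: "w \<notin> lists A \<Longrightarrow> word_class A R w = {}"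
  unfolding word_class_def using word_cong_in_lists by fastforce

lemma word_class_self: "w \<in> lists A \<Longrightarrow> w \<in> word_class A R w"
  unfolding word_class_def by (auto intro: word_cong.refl)

lemma word_class_eq_lists:
  assumes "word_class A R u = word_class A R v"
  shows "u \<in> lists A \<longleftrightarrow> v \<in> lists A"
proof -
  have "w \<in> lists A \<longleftrightarrow> word_class A R w \<noteq> {}" for w
    using word_class_outside[of w A R] word_class_self[of w A R] by blast
  then show ?thesis using assms by simp
qed

lemma word_class_append_cong:
  assumes "word_class A R u = word_class A R u'" "word_class A R v = word_class A R v'"
  shows "word_class A R (u @ v) = word_class A R (u' @ v')"
proof (cases "u \<in> lists A \<and> v \<in> lists A")
  case True
  then have in_lists: "u' \<in> lists A" "v' \<in> lists A"
    using word_class_eq_lists[OF assms(1)] word_class_eq_lists[OF assms(2)] by simp_all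
  then have "(u, u') \<in> word_cong A R" "(v, v') \<in> word_cong A R"
    using True assms by (simp_all add: word_class_eq_iff)
  then have "(u @ v, u' @ v') \<in> word_cong A R" by (rule word_cong_append)
  then show ?thesis using True in_lists by (simp add: word_class_eq_iff)
next
  case False
  then have "\<not> (u' \<in> lists A \<and> v' \<in> lists A)"
    using word_class_eq_lists[OF assms(1)] word_class_eq_lists[OF assms(2)] by simp
  with False have "u @ v \<notin> lists A" "u' @ v' \<notin> lists A" by auto
  then show ?thesis by (simp add: word_class_outside)
qed

lemma word_class_relation:
  assumes "(u, v) \<in> R" "u \<in> lists A \<longleftrightarrow> v \<in> lists A"
  shows "word_class A R u = word_class A R v"
proof (cases "u \<in> lists A")
  case True
  then have "(u, v) \<in> word_cong A R"
    using assms word_cong.base[of u v R A "[]" "[]"] by simp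
  then show ?thesis using True assms(2) by (simp add: word_class_eq_iff)
next
  case False
  then show ?thesis using assms(2) by (simp add: word_class_outside)
qed

definition fuse_class :: "nat \<Rightarrow> fuse_gen list \<Rightarrow> fuse_gen list set" where
  "fuse_class n w = word_class (fuse_gens n) (fuse_rels n) w"

lemma vsb_class_append_cong:
  "vsb_class n u = vsb_class n u' \<Longrightarrow> vsb_class n v = vsb_class n v' \<Longrightarrow>
    vsb_class n (u @ v) = vsb_class n (u' @ v')"
  unfolding vsb_class_def by (rule word_class_append_cong)

lemma vsb_class_context:
  "vsb_class n u = vsb_class n v \<Longrightarrow> vsb_class n (x @ u @ y) = vsb_class n (x @ v @ y)"
  by (intro vsb_class_append_cong HOL.refl)

lemma fuse_class_append_cong:
  "fuse_class n u = fuse_class n u' \<Longrightarrow> fuse_class n v = fuse_class n v' \<Longrightarrow>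
    fuse_class n (u @ v) = fuse_class n (u' @ v')"
  unfolding fuse_class_def by (rule word_class_append_cong)

lemma gen_in_vsb_gens [simp]:
  "Sig i \<in> vsb_gens n \<longleftrightarrow> i \<in> {1..<n}"
  "SigInv i \<in> vsb_gens n \<longleftrightarrow> i \<in> {1..<n}"
  "Virt i \<in> vsb_gens n \<longleftrightarrow> i \<in> {1..<n}"
  "Tau i \<in> vsb_gens n \<longleftrightarrow> i \<in> {1..<n}"
  by (auto simp: vsb_gens_def)

lemma gen_in_fuse_gens [simp]:
  "Mu k l \<in> fuse_gens n \<longleftrightarrow> k \<in> {1..n} \<and> l \<in> {1..n} \<and> k \<noteq> l"
  "MuInv k l \<in> fuse_gens n \<longleftrightarrow> k \<in> {1..n} \<and> l \<in> {1..n} \<and> k \<noteq> l"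
  "Gam k l \<in> fuse_gens n \<longleftrightarrow> k \<in> {1..n} \<and> l \<in> {1..n} \<and> k \<noteq> l"
  by (auto simp: fuse_gens_def)

lemma vsb_far_relation:
  assumes "g \<in> {Sig, Tau, Virt}" "h \<in> {Sig, Tau, Virt}" "i \<in> {1..<n}" "j \<in> {1..<n}"
    "\<bar>int i - int j\<bar> > 1"
  shows "([g i, h j], [h j, g i]) \<in> vsb_rels n"
  using assms unfolding vsb_rels_def by blast

lemma vsb_class_relation:
  "(u, v) \<in> vsb_rels n \<Longrightarrow> vsb_class n u = vsb_class n v"
  unfolding vsb_class_def
  by (rule word_class_relation, assumption, unfold vsb_rels_def)
     (elim UnE CollectE exE conjE; auto)

lemma fuse_class_relation:
  "(u, v) \<in> fuse_rels n \<Longrightarrow> fuse_class n u = fuse_class n v"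
  unfolding fuse_class_def
  by (rule word_class_relation, assumption, unfold fuse_rels_def)
     (elim UnE CollectE exE conjE; simp)

lemma vsb_class_eqD:
  "vsb_class n u = vsb_class n v \<Longrightarrow> u \<in> lists (vsb_gens n) \<Longrightarrow> v \<in> lists (vsb_gens n)"
  unfolding vsb_class_def using word_class_eq_lists by blast

lemma map_Virt_in_lists: "map Virt s \<in> lists (vsb_gens n) \<longleftrightarrow> s \<in> lists {1..<n}"
  by (induction s) auto


section \<open>Permutations of words\<close>

primrec word_perm :: "vsb_gen list \<Rightarrow> nat \<Rightarrow> nat" where
  "word_perm [] = id"
| "word_perm (a # w) = gen_perm a \<circ> word_perm w"

lemma word_perm_append: "word_perm (u @ w) = word_perm u \<circ> word_perm w"
  by (induction u) (auto simp: o_assoc)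

lemma word_perm_eq_word_val: "word_perm w = word_val (sym_group n) gen_perm w"
  by (induction w) (auto simp: word_val_def sym_group_mult sym_group_one)

lemma word_perm_permutes: "w \<in> lists (vsb_gens n) \<Longrightarrow> word_perm w permutes {1..n}"
  using monoid.word_val_closed[OF group.is_monoid[OF sym_group_is_group] gen_perm_in_sym_group]
  unfolding word_perm_eq_word_val[of w n] sym_group_carrier by blast

lemma word_perm_cong:
  assumes "vsb_class n u = vsb_class n v" "u \<in> lists (vsb_gens n)"
  shows "word_perm u = word_perm v"
proof -
  have "(u, v) \<in> word_cong (vsb_gens n) (vsb_rels n)"
    using assms vsb_class_eqD[OF assms] by (simp add: word_class_eq_iff vsb_class_def)
  from monoid.word_val_cong[OF group.is_monoid[OF sym_group_is_group] gen_perm_in_sym_group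
      gen_perm_respects_rels this]
  show ?thesis unfolding word_perm_eq_word_val[of _ n] .
qed

lemma vsb_perm_class:
  "w \<in> lists (vsb_gens n) \<Longrightarrow> vsb_perm n (vsb_class n w) = word_perm w"
  unfolding vsb_perm_def vsb_class_def word_perm_eq_word_val[of w n]
  by (intro monoid.induced_map_class[OF group.is_monoid[OF sym_group_is_group]
        gen_perm_in_sym_group gen_perm_respects_rels])


section \<open>Virtual generators and the symmetric group\<close>

lemma virt_sq: "i \<in> {1..<n} \<Longrightarrow> vsb_class n [Virt i, Virt i] = vsb_class n []"
  by (rule vsb_class_relation) (auto simp: vsb_rels_def)

lemma virt_sq_context:
  "i \<in> {1..<n} \<Longrightarrow> vsb_class n (x @ [Virt i, Virt i] @ y) = vsb_class n (x @ y)"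
  using vsb_class_context[OF virt_sq, of i n x y] by simp

lemma virt_braid: "vsb_class n [Virt i, Virt (Suc i), Virt i] =
    vsb_class n [Virt (Suc i), Virt i, Virt (Suc i)]"
proof (cases "i \<in> {1..<n} \<and> Suc i \<in> {1..<n}")
  case True
  then show ?thesis by (intro vsb_class_relation) (auto simp: vsb_rels_def)
next
  case False
  then show ?thesis unfolding vsb_class_def
    by (subst (1 2) word_class_outside) auto
qed

lemma virt_far:
  assumes "\<bar>int i - int j\<bar> > 1" "h \<in> {Sig, Tau, Virt}"
  shows "vsb_class n [Virt i, h j] = vsb_class n [h j, Virt i]"
proof (cases "i \<in> {1..<n} \<and> j \<in> {1..<n}")
  case True
  then show ?thesis using assms by (intro vsb_class_relation) (auto simp: vsb_rels_def)
next
  case False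
  then show ?thesis using assms(2) unfolding vsb_class_def
    by (subst (1 2) word_class_outside) auto
qed

lemma virt_word_cancel:
  "s \<in> lists {1..<n} \<Longrightarrow> vsb_class n (map Virt s @ map Virt (rev s)) = vsb_class n []"
proof (induction s)
  case (Cons i s)
  have "vsb_class n ([Virt i] @ (map Virt s @ map Virt (rev s)) @ [Virt i]) =
      vsb_class n ([Virt i] @ [] @ [Virt i])"
    by (rule vsb_class_context) (use Cons in auto)
  then show ?case using Cons.prems virt_sq[of i n] by simp
qed simp

lemma virt_right_cancel:
  assumes "vsb_class n (u @ map Virt s) = vsb_class n (w @ map Virt s)" "s \<in> lists {1..<n}"
  shows "vsb_class n u = vsb_class n w"
proof -
  have drop: "vsb_class n ((x @ map Virt s) @ map Virt (rev s)) = vsb_class n x" for x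
    using vsb_class_context[OF virt_word_cancel[OF assms(2)], of x "[]"] by simp
  show ?thesis
    using drop[of u] drop[of w] vsb_class_append_cong[OF assms(1) HOL.refl] by simp
qed

lemma virt_far_word:
  assumes "\<forall>j \<in> set s. \<bar>int i - int j\<bar> > 1"
  shows "vsb_class n (Virt i # map Virt s) = vsb_class n (map Virt s @ [Virt i])"
  using assms
proof (induction s)
  case (Cons j s)
  have "vsb_class n ([] @ [Virt i, Virt j] @ map Virt s) =
      vsb_class n ([] @ [Virt j, Virt i] @ map Virt s)"
    by (rule vsb_class_context) (use Cons.prems virt_far[of i j Virt n] in simp)
  moreover have "vsb_class n ([Virt j] @ (Virt i # map Virt s) @ []) =
      vsb_class n ([Virt j] @ (map Virt s @ [Virt i]) @ [])"
    by (rule vsb_class_context) (use Cons in auto)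
  ultimately show ?case by simp
qed simp

text \<open>The run \<open>v\<^sub>k \<dots> v\<^sub>m\<close> is a cycle that takes the transposition of a - 1 and a to that of
  a and a + 1. On words: move \<open>v\<^sub>a\<close> right until it meets \<open>v\<^bsub>a-1\<^esub> v\<^sub>a\<close>, apply the braid relation once,
  and move the resulting \<open>v\<^bsub>a-1\<^esub>\<close> through the rest.\<close>

lemma virt_slide_run:
  assumes "k < a" "a \<le> m"
  shows "vsb_class n (Virt a # map Virt [k..<Suc m]) =
    vsb_class n (map Virt [k..<Suc m] @ [Virt (a - 1)])"
proof -
  obtain b where b: "a = Suc b" "k \<le> b" using assms by (cases a) auto
  have "[k..<Suc m] = [k..<b] @ [b..<Suc m]"
    using b assms upt_add_eq_append[of k b "Suc m - b"] by simp
  also have "[b..<Suc m] = b # Suc b # [Suc (Suc b)..<Suc m]"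
    using b assms upt_conv_Cons by simp
  finally have run: "[k..<Suc m] = [k..<b] @ b # Suc b # [Suc (Suc b)..<Suc m]" .
  let ?x = "map Virt [k..<b]" and ?y = "map Virt [Suc (Suc b)..<Suc m]"
  have "vsb_class n (Virt a # map Virt [k..<Suc m]) =
      vsb_class n ([] @ (Virt (Suc b) # ?x) @ Virt b # Virt (Suc b) # ?y)"
    unfolding run b by simp
  also have "\<dots> = vsb_class n ([] @ (?x @ [Virt (Suc b)]) @ Virt b # Virt (Suc b) # ?y)"
    by (intro vsb_class_context virt_far_word) auto
  also have "\<dots> = vsb_class n (?x @ [Virt (Suc b), Virt b, Virt (Suc b)] @ ?y)" by simp
  also have "\<dots> = vsb_class n (?x @ [Virt b, Virt (Suc b), Virt b] @ ?y)"
    by (intro vsb_class_context virt_braid[symmetric])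
  also have "\<dots> = vsb_class n ((?x @ [Virt b, Virt (Suc b)]) @ (Virt b # ?y) @ [])" by simp
  also have "\<dots> = vsb_class n ((?x @ [Virt b, Virt (Suc b)]) @ (?y @ [Virt b]) @ [])"
    by (intro vsb_class_context virt_far_word) auto
  also have "\<dots> = vsb_class n (map Virt [k..<Suc m] @ [Virt (a - 1)])"
    unfolding run b by simp
  finally show ?thesis .
qed

text \<open>The runs \<open>v\<^sub>k \<dots> v\<^sub>m\<close> represent the cosets in the symmetric group on m + 1 letters of the
  stabilizer of m + 1. It suffices that left multiplication by a generator permutes these m + 1
  representatives up to a factor from the generators below m.\<close>

lemma virt_coset_form:
  assumes "s \<in> lists {1..<Suc m}" "m < n"
  shows "\<exists>k \<in> {1..Suc m}. \<exists>u \<in> lists {1..<m}.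
    vsb_class n (map Virt s) = vsb_class n (map Virt ([k..<Suc m] @ u))"
  using assms(1)
proof (induction rule: lists.induct)
  case Nil
  have "vsb_class n (map Virt []) = vsb_class n (map Virt ([Suc m..<Suc m] @ []))" by simp
  moreover have "Suc m \<in> {1..Suc m}" "[] \<in> lists {1..<m}" by auto
  ultimately show ?case by blast
next
  case (Cons a s)
  from Cons.IH obtain k u where k: "k \<in> {1..Suc m}" and u: "u \<in> lists {1..<m}"
    and s: "vsb_class n (map Virt s) = vsb_class n (map Virt ([k..<Suc m] @ u))" by blast
  have a: "a \<in> {1..<Suc m}" by (rule Cons.hyps)
  have step: "vsb_class n (map Virt (a # s)) =
      vsb_class n ((Virt a # map Virt [k..<Suc m]) @ map Virt u)"
    using vsb_class_append_cong[OF HOL.refl s, of "[Virt a]"] by simp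
  consider "Suc a < k" | "k = Suc a" | "a = k" | "k < a" by linarith
  then show ?case
  proof cases
    case 1
    have "vsb_class n (Virt a # map Virt [k..<Suc m]) =
        vsb_class n (map Virt [k..<Suc m] @ [Virt a])"
      by (rule virt_far_word) (use 1 in auto)
    from vsb_class_append_cong[OF this HOL.refl, of "map Virt u"]
    have "vsb_class n (map Virt (a # s)) = vsb_class n (map Virt ([k..<Suc m] @ (a # u)))"
      unfolding step by simp
    moreover have "a # u \<in> lists {1..<m}" using 1 k u a by auto
    ultimately show ?thesis using k by blast
  next
    case 2
    have "a # [Suc a..<Suc m] = [a..<Suc m]" using a upt_conv_Cons[of a "Suc m"] by auto
    then have "map Virt ([a..<Suc m] @ u) = (Virt a # map Virt [k..<Suc m]) @ map Virt u"
      unfolding 2 by (metis append_Cons list.simps(9) map_append)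
    then have "vsb_class n (map Virt (a # s)) = vsb_class n (map Virt ([a..<Suc m] @ u))"
      unfolding step by simp
    moreover have "a \<in> {1..Suc m}" using a by auto
    ultimately show ?thesis using u by blast
  next
    case 3
    have run: "[k..<Suc m] = a # [Suc a..<Suc m]" using 3 a upt_conv_Cons[of a "Suc m"] by auto
    have "vsb_class n (map Virt (a # s)) =
        vsb_class n ([] @ [Virt a, Virt a] @ map Virt ([Suc a..<Suc m] @ u))"
      unfolding step run by simp
    also have "\<dots> = vsb_class n ([] @ map Virt ([Suc a..<Suc m] @ u))"
      by (rule virt_sq_context) (use a assms(2) in auto)
    finally have "vsb_class n (map Virt (a # s)) = vsb_class n (map Virt ([Suc a..<Suc m] @ u))"
      by simp
    moreover have "Suc a \<in> {1..Suc m}" using a by auto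
    ultimately show ?thesis using u by blast
  next
    case 4
    have "vsb_class n (Virt a # map Virt [k..<Suc m]) =
        vsb_class n (map Virt [k..<Suc m] @ [Virt (a - 1)])"
      by (rule virt_slide_run) (use 4 a in auto)
    from vsb_class_append_cong[OF this HOL.refl, of "map Virt u"]
    have "vsb_class n (map Virt (a # s)) = vsb_class n (map Virt ([k..<Suc m] @ ((a - 1) # u)))"
      unfolding step by simp
    moreover have "(a - 1) # u \<in> lists {1..<m}" using 4 k u a by auto
    ultimately show ?thesis using k by blast
  qed
qed

lemma word_perm_run: "k \<le> Suc m \<Longrightarrow> word_perm (map Virt [k..<Suc m]) (Suc m) = k"
proof (induction "Suc m - k" arbitrary: k)
  case (Suc d)
  then have "[k..<Suc m] = k # [Suc k..<Suc m]" using upt_conv_Cons[of k "Suc m"] by simp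
  moreover have "word_perm (map Virt [Suc k..<Suc m]) (Suc m) = Suc k"
    using Suc(1)[of "Suc k"] Suc(2,3) by simp
  ultimately show ?case by (simp del: upt_Suc)
qed simp

lemma word_perm_fixes:
  "\<forall>i \<in> set u. Suc i < x \<Longrightarrow> word_perm (map Virt u) x = x"
  by (induction u) (auto simp: transpose_def)

text \<open>The permutation of a word in coset form determines its run, since it sends m + 1 to the first
  index k. For the identity the run is empty and the word uses fewer generators.\<close>

lemma virt_word_trivial_aux:
  assumes "s \<in> lists {1..<m}" "m \<le> n" "word_perm (map Virt s) = id"
  shows "vsb_class n (map Virt s) = vsb_class n []"
  using assms
proof (induction m arbitrary: s)
  case 0
  then show ?case by (cases s) auto
next
  case (Suc m)

  have words: "map Virt s \<in> lists (vsb_gens n)"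
    using Suc.prems(1,2) unfolding map_Virt_in_lists by auto
  obtain k u where k: "k \<in> {1..Suc m}" and u: "u \<in> lists {1..<m}"
    and s: "vsb_class n (map Virt s) = vsb_class n (map Virt ([k..<Suc m] @ u))"
    using virt_coset_form[of s m n] Suc.prems(1,2) Suc_le_lessD by blast
  have perm: "word_perm (map Virt [k..<Suc m] @ map Virt u) = id"
    using word_perm_cong[OF s words] Suc.prems(3) by (metis map_append)
  have "word_perm (map Virt u) (Suc m) = Suc m"
    by (rule word_perm_fixes) (use u in auto)
  then have "word_perm (map Virt [k..<Suc m] @ map Virt u) (Suc m) = k"
    using word_perm_run[of k m] k unfolding word_perm_append by auto
  with perm have "k = Suc m" by simp
  with s perm have "vsb_class n (map Virt s) = vsb_class n (map Virt u)"
    "word_perm (map Virt u) = id" by simp_all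
  then show ?case using Suc.IH[of u] u Suc.prems(2) by simp
qed

lemma virt_word_eq:
  assumes "s \<in> lists {1..<n}" "t \<in> lists {1..<n}"
    and "word_perm (map Virt s) = word_perm (map Virt t)"
  shows "vsb_class n (map Virt s) = vsb_class n (map Virt t)"
proof (rule virt_right_cancel)
  have t: "map Virt t @ map Virt (rev t) \<in> lists (vsb_gens n)"
    using assms(2) map_Virt_in_lists[of "t @ rev t" n] by auto
  have triv: "vsb_class n (map Virt t @ map Virt (rev t)) = vsb_class n []"
    by (rule virt_word_cancel) fact
  have "word_perm (map Virt t @ map Virt (rev t)) = id"
    using word_perm_cong[OF triv t] by simp
  then have "word_perm (map Virt (s @ rev t)) = id"
    using assms(3) by (simp add: word_perm_append)
  moreover have "s @ rev t \<in> lists {1..<n}" using assms(1,2) by auto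
  ultimately have "vsb_class n (map Virt (s @ rev t)) = vsb_class n []"
    using virt_word_trivial_aux[of "s @ rev t" n n] by blast
  then show "vsb_class n (map Virt s @ map Virt (rev t)) =
      vsb_class n (map Virt t @ map Virt (rev t))"
    using triv by simp
  show "rev t \<in> lists {1..<n}" using assms(2) by auto
qed


section \<open>Conjugation by virtual generators\<close>

definition virt_conj :: "nat \<Rightarrow> vsb_gen list \<Rightarrow> vsb_gen list" where
  "virt_conj m w = Virt m # w @ [Virt m]"

lemma virt_conj_cong:
  "vsb_class n u = vsb_class n w \<Longrightarrow> vsb_class n (virt_conj m u) = vsb_class n (virt_conj m w)"
  using vsb_class_context[of n u w "[Virt m]" "[Virt m]"] by (simp add: virt_conj_def)

lemma virt_conj_twice:
  assumes "m \<in> {1..<n}"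
  shows "vsb_class n (virt_conj m (virt_conj m w)) = vsb_class n w"
  using virt_sq_context[OF assms, of "[]" "w @ [Virt m, Virt m]"] virt_sq_context[OF assms, of w "[]"]
  by (simp add: virt_conj_def)

lemma virt_conj_append:
  assumes "m \<in> {1..<n}"
  shows "vsb_class n (virt_conj m u @ virt_conj m w) = vsb_class n (virt_conj m (u @ w))"
  using virt_sq_context[OF assms, of "Virt m # u" "w @ [Virt m]"] by (simp add: virt_conj_def)

lemma virt_conj_Nil: "m \<in> {1..<n} \<Longrightarrow> vsb_class n (virt_conj m []) = vsb_class n []"
  using virt_sq[of m n] by (simp add: virt_conj_def)

lemma virt_conj_far:
  assumes "\<bar>int i - int j\<bar> > 1"
  shows "vsb_class n (virt_conj i (virt_conj j w)) = vsb_class n (virt_conj j (virt_conj i w))"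
proof -
  have swap: "vsb_class n [Virt i, Virt j] = vsb_class n [Virt j, Virt i]"
    using virt_far[OF assms, of Virt n] by simp
  have "vsb_class n ([Virt i, Virt j] @ w @ [Virt j, Virt i]) =
      vsb_class n ([Virt j, Virt i] @ w @ [Virt i, Virt j])"
    by (intro vsb_class_append_cong swap swap[symmetric] HOL.refl)
  then show ?thesis by (simp add: virt_conj_def)
qed

lemma virt_conj_braid:
  "vsb_class n (virt_conj i (virt_conj (Suc i) (virt_conj i w))) =
   vsb_class n (virt_conj (Suc i) (virt_conj i (virt_conj (Suc i) w)))"
proof -
  have "vsb_class n ([Virt i, Virt (Suc i), Virt i] @ w @ [Virt i, Virt (Suc i), Virt i]) =
      vsb_class n ([Virt (Suc i), Virt i, Virt (Suc i)] @ w @ [Virt (Suc i), Virt i, Virt (Suc i)])"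
    by (intro vsb_class_append_cong virt_braid HOL.refl)
  then show ?thesis by (simp add: virt_conj_def)
qed

text \<open>In this form a fusing string from k to l grows by one conjugation at a time, so statements about
  all of them can be proved by induction on l.\<close>

lemma detour_Suc: "k < l \<Longrightarrow> detour k (Suc l) w = virt_conj l (detour k l w)"
  by (simp add: detour_def virt_conj_def)

lemma detour_adjacent: "detour k (Suc k) w = w"
  by (simp add: detour_def)

text \<open>What the words for \<open>\<mu>\<^sub>i\<close>, \<open>\<mu>\<^sub>i\<^sup>-\<^sup>1\<close> and \<open>\<gamma>\<^sub>i\<close> have in common under conjugation by the \<open>v\<^sub>j\<close>. These
  two properties are enough for the strings built from them to be permuted like ordered pairs of
  indices.\<close>

locale virt_family =
  fixes n :: nat and b :: "nat \<Rightarrow> vsb_gen list"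
  assumes adjacent: "\<And>i. i \<in> {1..<n} \<Longrightarrow> Suc i \<in> {1..<n} \<Longrightarrow>
      vsb_class n (virt_conj i (b (Suc i))) = vsb_class n (virt_conj (Suc i) (b i))"
    and far: "\<And>i j. i \<in> {1..<n} \<Longrightarrow> j \<in> {1..<n} \<Longrightarrow> \<bar>int i - int j\<bar> > 1 \<Longrightarrow>
      vsb_class n (virt_conj i (b j)) = vsb_class n (b j)"
begin

lemma conj_outside:
  assumes "1 \<le> k" "k < l" "l \<le> n" "m \<in> {1..<n}" "Suc m < k \<or> l < m"
  shows "vsb_class n (virt_conj m (detour k l (b k))) = vsb_class n (detour k l (b k))"
proof -
  have "Suc k \<le> l" using assms(2) by simp
  then show ?thesis using assms(3,5)
  proof (induction l rule: dec_induct)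
    case base
    then show ?case unfolding detour_adjacent using assms(1,4) by (intro far) auto
  next
    case (step l)
    have "vsb_class n (virt_conj m (virt_conj l (detour k l (b k)))) =
        vsb_class n (virt_conj l (virt_conj m (detour k l (b k))))"
      by (rule virt_conj_far) (use step in auto)
    also have "\<dots> = vsb_class n (virt_conj l (detour k l (b k)))"
      by (rule virt_conj_cong) (use step in auto)
    finally show ?case using step(1) by (simp add: detour_Suc)
  qed
qed

text \<open>The string that ends at m + 2 is the string that ends at m, conjugated by \<open>v\<^bsub>m+1\<^esub> v\<^sub>m\<close>. The braid
  relation moves a further \<open>v\<^sub>m\<close> through these two as \<open>v\<^bsub>m+1\<^esub>\<close>, which fixes the string that ends
  at m.\<close>

lemma conj_between:
  assumes "1 \<le> k" "k < m" "Suc m < l" "l \<le> n"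
  shows "vsb_class n (virt_conj m (detour k l (b k))) = vsb_class n (detour k l (b k))"
proof -
  have "Suc (Suc m) \<le> l" using assms(3) by simp
  then show ?thesis using assms(4)
  proof (induction l rule: dec_induct)
    case base
    have "vsb_class n (virt_conj m (virt_conj (Suc m) (virt_conj m (detour k m (b k))))) =
        vsb_class n (virt_conj (Suc m) (virt_conj m (virt_conj (Suc m) (detour k m (b k)))))"
      by (rule virt_conj_braid)
    also have "\<dots> = vsb_class n (virt_conj (Suc m) (virt_conj m (detour k m (b k))))"
      by (intro virt_conj_cong conj_outside) (use assms base in auto)
    finally show ?case using assms(2) by (simp add: detour_Suc)
  next
    case (step l)
    have "vsb_class n (virt_conj m (virt_conj l (detour k l (b k)))) =
        vsb_class n (virt_conj l (virt_conj m (detour k l (b k))))"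
      by (rule virt_conj_far) (use step in auto)
    also have "\<dots> = vsb_class n (virt_conj l (detour k l (b k)))"
      by (rule virt_conj_cong) (use step in auto)
    finally show ?case using step(1) assms(2) by (simp add: detour_Suc)
  qed
qed

lemma conj_left_end:
  assumes "1 \<le> k" "Suc k < l" "l \<le> n"
  shows "vsb_class n (virt_conj k (detour k l (b k))) =
    vsb_class n (detour (Suc k) l (b (Suc k)))"
proof -
  have "Suc (Suc k) \<le> l" using assms(2) by simp
  then show ?thesis using assms(3)
  proof (induction l rule: dec_induct)
    case base
    have "vsb_class n (virt_conj k (virt_conj (Suc k) (b k))) =
        vsb_class n (virt_conj k (virt_conj k (b (Suc k))))"
      by (intro virt_conj_cong adjacent[symmetric]) (use assms(1) base in auto)
    also have "\<dots> = vsb_class n (b (Suc k))"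
      by (rule virt_conj_twice) (use assms(1) base in auto)
    finally show ?case by (simp add: detour_Suc detour_adjacent)
  next
    case (step l)
    have "vsb_class n (virt_conj k (virt_conj l (detour k l (b k)))) =
        vsb_class n (virt_conj l (virt_conj k (detour k l (b k))))"
      by (rule virt_conj_far) (use step in auto)
    also have "\<dots> = vsb_class n (virt_conj l (detour (Suc k) l (b (Suc k))))"
      by (rule virt_conj_cong) (use step in auto)
    finally show ?case using step(1) by (simp add: detour_Suc)
  qed
qed

text \<open>The excluded case m = k, l = k + 1 is where the two indices change their order; there the
  result is a string of the mirrored family.\<close>

lemma conj_detour:
  assumes "1 \<le> k" "k < l" "l \<le> n" "m \<in> {1..<n}" "\<not> (m = k \<and> l = Suc k)"
  defines "t \<equiv> transpose m (Suc m)"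
  shows "vsb_class n (virt_conj m (detour k l (b k))) = vsb_class n (detour (t k) (t l) (b (t k)))"
    and "t k < t l"
proof -
  show "t k < t l" using assms by (auto simp: transpose_def)
  consider "Suc m < k \<or> l < m" | "k = Suc m" | "m = k" "Suc k < l" | "k < m" "Suc m < l"
    | "k < m" "l = Suc m" | "m = l" using assms(2,5) by linarith
  then show "vsb_class n (virt_conj m (detour k l (b k))) =
      vsb_class n (detour (t k) (t l) (b (t k)))"
  proof cases
    case 1
    then have "t k = k" "t l = l" using assms(2) by (auto simp: t_def transpose_def)
    then show ?thesis using conj_outside[of k l m] assms 1 by simp
  next
    case 2
    then have "t k = m" "t l = l" using assms(2) by (auto simp: t_def transpose_def)
    moreover have "vsb_class n (virt_conj m (detour k l (b k))) =
        vsb_class n (virt_conj m (virt_conj m (detour m l (b m))))"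
      unfolding 2 by (intro virt_conj_cong conj_left_end[symmetric]) (use assms 2 in auto)
    ultimately show ?thesis using virt_conj_twice[OF assms(4)] by simp
  next
    case 3
    then have "t k = Suc k" "t l = l" by (auto simp: t_def transpose_def)
    then show ?thesis using conj_left_end[of k l] assms 3 by simp
  next
    case 4
    then have "t k = k" "t l = l" by (auto simp: t_def transpose_def)
    then show ?thesis using conj_between[of k m l] assms 4 by simp
  next
    case 5
    then have "t k = k" "t l = m" by (auto simp: t_def transpose_def)
    then show ?thesis using 5 virt_conj_twice[OF assms(4)] by (simp add: detour_Suc)
  next
    case 6
    then have "t k = k" "t l = Suc l" using assms(2) by (auto simp: t_def transpose_def)
    then show ?thesis using 6 assms(2) by (simp add: detour_Suc)
  qed
qed

text \<open>The strings with decreasing indices are built from the words \<open>v\<^sub>i b\<^sub>i v\<^sub>i\<close>. As these form a family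
  of the same kind, everything shown for increasing indices applies to them.\<close>

lemma mirrored: "virt_family n (\<lambda>i. virt_conj i (b i))"
proof
  fix i assume i: "i \<in> {1..<n}" "Suc i \<in> {1..<n}"
  let ?c = "vsb_class n" and ?v = "virt_conj i" and ?w = "virt_conj (Suc i)"
  have "?c (?v (?w (b (Suc i)))) = ?c (?v (?w (?v (?v (b (Suc i))))))"
    by (intro virt_conj_cong virt_conj_twice[symmetric] i)
  also have "\<dots> = ?c (?v (?w (?v (?w (b i)))))"
    by (intro virt_conj_cong adjacent i)
  also have "\<dots> = ?c (?w (?v (?w (?w (b i)))))"
    by (rule virt_conj_braid)
  also have "\<dots> = ?c (?w (?v (b i)))"
    by (intro virt_conj_cong virt_conj_twice i)
  finally show "?c (?v (?w (b (Suc i)))) = ?c (?w (?v (b i)))" .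
next
  fix i j assume ij: "i \<in> {1..<n}" "j \<in> {1..<n}" "\<bar>int i - int j\<bar> > 1"
  have "vsb_class n (virt_conj i (virt_conj j (b j))) = vsb_class n (virt_conj j (virt_conj i (b j)))"
    by (rule virt_conj_far) (rule ij)
  also have "\<dots> = vsb_class n (virt_conj j (b j))"
    by (intro virt_conj_cong far ij)
  finally show "vsb_class n (virt_conj i (virt_conj j (b j))) = vsb_class n (virt_conj j (b j))" .
qed

end

text \<open>The common shape of the words that define \<open>\<mu>\<^bsub>kl\<^esub>\<close>, \<open>\<mu>\<^bsub>kl\<^esub>\<^sup>-\<^sup>1\<close> and \<open>\<gamma>\<^bsub>kl\<^esub>\<close>.\<close>

definition strand :: "(nat \<Rightarrow> vsb_gen list) \<Rightarrow> nat \<Rightarrow> nat \<Rightarrow> vsb_gen list" where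
  "strand b k l = (if k < l then detour k l (b k) else detour l k (virt_conj l (b l)))"

text \<open>Conjugation by \<open>v\<^sub>m\<close> leaves the family of increasing strings, or the mirrored one, exactly when it
  swaps the two neighbouring indices m and m + 1, and then it is the definition of the mirrored
  string.\<close>

lemma (in virt_family) conj_strand:
  assumes "k \<in> {1..n}" "l \<in> {1..n}" "k \<noteq> l" "m \<in> {1..<n}"
  defines "t \<equiv> transpose m (Suc m)"
  shows "vsb_class n (virt_conj m (strand b k l)) = vsb_class n (strand b (t k) (t l))"
proof -
  interpret mirror: virt_family n "\<lambda>i. virt_conj i (b i)" by (rule mirrored)
  consider "m = k" "l = Suc k" | "m = l" "k = Suc l" | "k < l" "\<not> (m = k \<and> l = Suc k)"
    | "l < k" "\<not> (m = l \<and> k = Suc l)" using assms(3) by linarith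
  then show ?thesis
  proof cases
    case 1
    then show ?thesis by (simp add: strand_def t_def detour_adjacent)
  next
    case 2
    then show ?thesis using virt_conj_twice[OF assms(4)]
      by (simp add: strand_def t_def detour_adjacent)
  next
    case 3
    then show ?thesis using conj_detour[of k l m] assms by (simp add: strand_def)
  next
    case 4
    then show ?thesis using mirror.conj_detour[of l k m] assms by (simp add: strand_def)
  qed
qed

lemma virt_conj_generator:
  assumes "g \<in> {Sig, Tau}" "i \<in> {1..<n}" "Suc i \<in> {1..<n}"
  shows "vsb_class n [Virt i, g (Suc i), Virt i] =
    vsb_class n [Virt (Suc i), g i, Virt (Suc i)]"
  by (rule vsb_class_relation) (use assms in \<open>auto simp: vsb_rels_def\<close>)

lemma virt_family_generator:
  assumes g: "g \<in> {Sig, Tau}"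
  shows "virt_family n (\<lambda>i. [g i, Virt i])"
proof
  fix i assume i: "i \<in> {1..<n}" "Suc i \<in> {1..<n}"
  let ?j = "Suc i"
  (* Inserting v_i v_i exposes a left side of a conjugation relation and one of a braid relation. *)
  have "vsb_class n [Virt i, g ?j, Virt ?j, Virt i] =
      vsb_class n ([Virt i, g ?j] @ [Virt i, Virt i] @ [Virt ?j, Virt i])"
    using virt_sq_context[OF i(1), of "[Virt i, g ?j]"] by simp
  also have "\<dots> = vsb_class n ([Virt i, g ?j, Virt i] @ [Virt i, Virt ?j, Virt i])" by simp
  also have "\<dots> = vsb_class n ([Virt ?j, g i, Virt ?j] @ [Virt ?j, Virt i, Virt ?j])"
    by (intro vsb_class_append_cong virt_conj_generator virt_braid g i)
  also have "\<dots> = vsb_class n ([Virt ?j, g i] @ [Virt ?j, Virt ?j] @ [Virt i, Virt ?j])" by simp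
  also have "\<dots> = vsb_class n ([Virt ?j, g i] @ [Virt i, Virt ?j])"
    by (rule virt_sq_context) (rule i)
  finally show "vsb_class n (virt_conj i [g ?j, Virt ?j]) = vsb_class n (virt_conj ?j [g i, Virt i])"
    by (simp add: virt_conj_def)
next
  fix i j assume ij: "i \<in> {1..<n}" "j \<in> {1..<n}" "\<bar>int i - int j\<bar> > 1"
  have "vsb_class n ([] @ [Virt i, g j] @ [Virt j, Virt i]) =
      vsb_class n ([] @ [g j, Virt i] @ [Virt j, Virt i])"
    by (intro vsb_class_context virt_far) (use g ij in auto)
  also have "\<dots> = vsb_class n ([g j] @ [Virt i, Virt j] @ [Virt i])" by simp
  also have "\<dots> = vsb_class n ([g j] @ [Virt j, Virt i] @ [Virt i])"
    by (intro vsb_class_context virt_far) (use ij in auto)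
  also have "\<dots> = vsb_class n ([g j, Virt j] @ [Virt i, Virt i] @ [])" by simp
  also have "\<dots> = vsb_class n ([g j, Virt j] @ [])"
    by (rule virt_sq_context) (rule ij)
  finally show "vsb_class n (virt_conj i [g j, Virt j]) = vsb_class n [g j, Virt j]"
    by (simp add: virt_conj_def)
qed

text \<open>This turns relations between invertible words into relations between their inverses. It is how the
  behaviour of \<open>\<sigma>\<^sub>i\<^sup>-\<^sup>1\<close> under conjugation follows from that of \<open>\<sigma>\<^sub>i\<close>.\<close>

lemma vsb_class_inverse_unique:
  assumes "vsb_class n (v @ u) = vsb_class n []" "vsb_class n (u' @ v') = vsb_class n []"
    and "vsb_class n u = vsb_class n u'"
  shows "vsb_class n v = vsb_class n v'"
proof -
  have "vsb_class n v = vsb_class n (v @ u' @ v')"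
    using vsb_class_context[OF assms(2), of v "[]"] by simp
  also have "\<dots> = vsb_class n (v @ u @ v')"
    by (intro vsb_class_context assms(3)[symmetric])
  also have "\<dots> = vsb_class n v'"
    using vsb_class_context[OF assms(1), of "[]" v'] by simp
  finally show ?thesis .
qed

definition mu_inv_word :: "nat \<Rightarrow> vsb_gen list" where
  "mu_inv_word i = [Virt i, SigInv i]"

lemma mu_word_inverse:
  assumes i: "i \<in> {1..<n}"
  shows "vsb_class n (mu_word i @ mu_inv_word i) = vsb_class n []"
    and "vsb_class n (mu_inv_word i @ mu_word i) = vsb_class n []"
proof -
  have sig: "vsb_class n [Sig i, SigInv i] = vsb_class n []"
    "vsb_class n [SigInv i, Sig i] = vsb_class n []"
    by (rule vsb_class_relation; use i in \<open>auto simp: vsb_rels_def\<close>)+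
  show "vsb_class n (mu_word i @ mu_inv_word i) = vsb_class n []"
    using virt_sq_context[OF i, of "[Sig i]" "[SigInv i]"] sig(1)
    by (simp add: mu_word_def mu_inv_word_def)
  show "vsb_class n (mu_inv_word i @ mu_word i) = vsb_class n []"
    using vsb_class_context[OF sig(2), of "[Virt i]" "[Virt i]"] virt_sq[OF i]
    by (simp add: mu_word_def mu_inv_word_def)
qed

lemma virt_family_mu: "virt_family n mu_word"
  using virt_family_generator[of Sig n] by (simp add: mu_word_def[abs_def])

lemma virt_family_gamma: "virt_family n gamma_word"
  using virt_family_generator[of Tau n] by (simp add: gamma_word_def[abs_def])

lemma virt_family_mu_inv: "virt_family n mu_inv_word"
proof -
  interpret mu: virt_family n mu_word by (rule virt_family_mu)
  have conj_inverse: "vsb_class n (virt_conj i (mu_word j) @ virt_conj i (mu_inv_word j)) = vsb_class n []"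
    "vsb_class n (virt_conj i (mu_inv_word j) @ virt_conj i (mu_word j)) = vsb_class n []"
    if "i \<in> {1..<n}" "j \<in> {1..<n}" for i j
    using virt_conj_append[OF that(1)] virt_conj_Nil[OF that(1)]
      virt_conj_cong[OF mu_word_inverse(1)[OF that(2)], of i]
      virt_conj_cong[OF mu_word_inverse(2)[OF that(2)], of i] by simp_all
  show ?thesis
  proof
    fix i assume i: "i \<in> {1..<n}" "Suc i \<in> {1..<n}"
    show "vsb_class n (virt_conj i (mu_inv_word (Suc i))) =
        vsb_class n (virt_conj (Suc i) (mu_inv_word i))"
      by (rule vsb_class_inverse_unique[OF conj_inverse(2) conj_inverse(1) mu.adjacent])
         (use i in auto)
  next
    fix i j assume "i \<in> {1..<n}" "j \<in> {1..<n}" "\<bar>int i - int j\<bar> > 1"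
    then show "vsb_class n (virt_conj i (mu_inv_word j)) = vsb_class n (mu_inv_word j)"
      by (intro vsb_class_inverse_unique[OF conj_inverse(2) mu_word_inverse(1) mu.far])
  qed
qed


section \<open>Fusing strings as words\<close>

fun letter_word :: "fuse_gen \<Rightarrow> vsb_gen list" where
  "letter_word (Mu k l) = strand mu_word k l"
| "letter_word (MuInv k l) = strand mu_inv_word k l"
| "letter_word (Gam k l) = strand gamma_word k l"

abbreviation fuse_word :: "fuse_gen list \<Rightarrow> vsb_gen list" where
  "fuse_word u \<equiv> concat (map letter_word u)"

fun relabel :: "(nat \<Rightarrow> nat) \<Rightarrow> fuse_gen \<Rightarrow> fuse_gen" where
  "relabel p (Mu k l) = Mu (p k) (p l)"
| "relabel p (MuInv k l) = MuInv (p k) (p l)"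
| "relabel p (Gam k l) = Gam (p k) (p l)"

lemma relabel_id [simp]: "relabel id x = x" "relabel (\<lambda>a. a) x = x"
  by (cases x; simp)+

lemma relabel_comp: "relabel p (relabel q x) = relabel (p \<circ> q) x"
  by (cases x) auto

lemma permutes_apply_eq_iff: "p permutes A \<Longrightarrow> p x = p y \<longleftrightarrow> x = y"
  using permutes_inj by (auto dest: injD)

lemma relabel_in_fuse_gens:
  assumes "p permutes {1..n}" "x \<in> fuse_gens n"
  shows "relabel p x \<in> fuse_gens n"
  using assms(2) permutes_in_image[OF assms(1)] permutes_apply_eq_iff[OF assms(1)]
  by (cases x) (simp_all del: atLeastAtMost_iff)

lemma detour_in_lists:
  "1 \<le> i \<Longrightarrow> j \<le> n \<Longrightarrow> c \<in> lists (vsb_gens n) \<Longrightarrow> detour i j c \<in> lists (vsb_gens n)"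
  by (auto simp: detour_def)

lemma letter_word_in_lists:
  assumes "x \<in> fuse_gens n"
  shows "letter_word x \<in> lists (vsb_gens n)"
proof -
  have "strand b k l \<in> lists (vsb_gens n)"
    if "k \<in> {1..n}" "l \<in> {1..n}" "k \<noteq> l" "\<forall>i \<in> {1..<n}. b i \<in> lists (vsb_gens n)" for b k l
  proof (cases "k < l")
    case True
    then have "detour k l (b k) \<in> lists (vsb_gens n)"
      using that by (intro detour_in_lists) auto
    then show ?thesis using True by (simp add: strand_def)
  next
    case False
    have "l \<in> {1..<n}" using that(1-3) False by auto
    then have "virt_conj l (b l) \<in> lists (vsb_gens n)"
      using that(4) by (simp add: virt_conj_def)
    then have "detour l k (virt_conj l (b l)) \<in> lists (vsb_gens n)"
      using that(1,2) by (intro detour_in_lists) auto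
    then show ?thesis using False by (simp add: strand_def)
  qed
  moreover have "\<forall>i \<in> {1..<n}. b i \<in> lists (vsb_gens n)"
    if "b \<in> {mu_word, mu_inv_word, gamma_word}" for b
    using that by (auto simp: mu_word_def mu_inv_word_def gamma_word_def)
  ultimately show ?thesis using assms by (cases x) auto
qed

lemma fuse_word_in_lists:
  "u \<in> lists (fuse_gens n) \<Longrightarrow> fuse_word u \<in> lists (vsb_gens n)"
  using letter_word_in_lists by (induction u) fastforce+

lemma conj_letter_word:
  assumes "x \<in> fuse_gens n" "m \<in> {1..<n}"
  shows "vsb_class n (virt_conj m (letter_word x)) =
    vsb_class n (letter_word (relabel (transpose m (Suc m)) x))"
  using assms virt_family.conj_strand[OF virt_family_mu, of _ n _ m]
    virt_family.conj_strand[OF virt_family_mu_inv, of _ n _ m]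
    virt_family.conj_strand[OF virt_family_gamma, of _ n _ m]
  by (cases x) simp_all

lemma virt_word_letter_word:
  assumes "s \<in> lists {1..<n}" "x \<in> fuse_gens n"
  shows "vsb_class n (map Virt s @ letter_word x) =
    vsb_class n (letter_word (relabel (word_perm (map Virt s)) x) @ map Virt s)"
  using assms(1)
proof (induction rule: lists.induct)
  case Nil
  then show ?case by simp
next
  case (Cons m s)
  let ?y = "relabel (word_perm (map Virt s)) x"
  let ?z = "relabel (transpose m (Suc m)) ?y"
  have y: "?y \<in> fuse_gens n"
    using Cons.hyps(2) assms(2) by (intro relabel_in_fuse_gens word_perm_permutes)
      (simp_all only: map_Virt_in_lists)
  have "vsb_class n (map Virt (m # s) @ letter_word x) =
      vsb_class n ([Virt m] @ (map Virt s @ letter_word x) @ [])" by simp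
  also have "\<dots> = vsb_class n ([Virt m] @ (letter_word ?y @ map Virt s) @ [])"
    by (rule vsb_class_context) (rule Cons.IH)
  also have "\<dots> = vsb_class n ((virt_conj m (letter_word ?y) @ [Virt m]) @ map Virt s)"
    using virt_sq_context[OF Cons.hyps(1), of "Virt m # letter_word ?y" "map Virt s"]
    by (simp add: virt_conj_def)
  also have "\<dots> = vsb_class n ((letter_word ?z @ [Virt m]) @ map Virt s)"
    by (intro vsb_class_append_cong conj_letter_word y Cons.hyps(1) HOL.refl)
  finally have "vsb_class n (map Virt (m # s) @ letter_word x) =
      vsb_class n (letter_word ?z @ map Virt (m # s))" by simp
  moreover have "?z = relabel (word_perm (map Virt (m # s))) x"
    unfolding relabel_comp by simp
  ultimately show ?case by (simp only:)
qed

lemma virt_word_fuse_word: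
  assumes "s \<in> lists {1..<n}" "u \<in> lists (fuse_gens n)"
  shows "vsb_class n (map Virt s @ fuse_word u) =
    vsb_class n (fuse_word (map (relabel (word_perm (map Virt s))) u) @ map Virt s)"
  using assms(2)
proof (induction rule: lists.induct)
  case Nil
  then show ?case by simp
next
  case (Cons x u)
  let ?r = "relabel (word_perm (map Virt s))"
  have "vsb_class n ([] @ (map Virt s @ letter_word x) @ fuse_word u) =
      vsb_class n ([] @ (letter_word (?r x) @ map Virt s) @ fuse_word u)"
    by (intro vsb_class_context virt_word_letter_word assms(1) Cons.hyps)
  also have "\<dots> = vsb_class n (letter_word (?r x) @ (map Virt s @ fuse_word u) @ [])" by simp
  also have "\<dots> = vsb_class n (letter_word (?r x) @ (fuse_word (map ?r u) @ map Virt s) @ [])"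
    by (rule vsb_class_context) (rule Cons.IH)
  finally show ?case by simp
qed


section \<open>Rewriting braid words into fusing strings\<close>

text \<open>Each generator is a fusing string times \<open>v\<^sub>i\<close>. For \<open>\<sigma>\<^sub>i\<^sup>-\<^sup>1\<close> the indices are reversed:
  \<open>\<sigma>\<^sub>i\<^sup>-\<^sup>1 = v\<^sub>i \<mu>\<^sub>i\<^sup>-\<^sup>1 = (v\<^sub>i \<mu>\<^sub>i\<^sup>-\<^sup>1 v\<^sub>i) v\<^sub>i\<close>.\<close>

fun gen_letter :: "vsb_gen \<Rightarrow> fuse_gen list" where
  "gen_letter (Sig i) = [Mu i (Suc i)]"
| "gen_letter (SigInv i) = [MuInv (Suc i) i]"
| "gen_letter (Virt i) = []"
| "gen_letter (Tau i) = [Gam i (Suc i)]"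

fun gen_index :: "vsb_gen \<Rightarrow> nat" where
  "gen_index (Sig i) = i"
| "gen_index (SigInv i) = i"
| "gen_index (Virt i) = i"
| "gen_index (Tau i) = i"

text \<open>The Reidemeister-Schreier rewriting process; p is the permutation of the prefix already read.\<close>

primrec rewrite :: "(nat \<Rightarrow> nat) \<Rightarrow> vsb_gen list \<Rightarrow> fuse_gen list" where
  "rewrite p [] = []"
| "rewrite p (a # w) = map (relabel p) (gen_letter a) @ rewrite (p \<circ> gen_perm a) w"

lemma rewrite_append: "rewrite p (u @ w) = rewrite p u @ rewrite (p \<circ> word_perm u) w"
  by (induction u arbitrary: p) (auto simp: o_assoc)

lemma gen_letter_in_lists: "a \<in> vsb_gens n \<Longrightarrow> gen_letter a \<in> lists (fuse_gens n)"
  by (cases a) auto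

lemma gen_index_in: "a \<in> vsb_gens n \<Longrightarrow> gen_index a \<in> {1..<n}"
  by (cases a) auto

lemma word_perm_gen_index: "word_perm [Virt (gen_index a)] = gen_perm a"
  by (cases a) auto

lemma gen_perm_permutes: "a \<in> vsb_gens n \<Longrightarrow> gen_perm a permutes {1..n}"
  using word_perm_permutes[of "[a]" n] by simp

lemma rewrite_in_lists:
  "w \<in> lists (vsb_gens n) \<Longrightarrow> p permutes {1..n} \<Longrightarrow> rewrite p w \<in> lists (fuse_gens n)"
proof (induction w arbitrary: p)
  case (Cons a w)
  have "map (relabel p) (gen_letter a) \<in> lists (fuse_gens n)"
    using relabel_in_fuse_gens[OF Cons.prems(2)] gen_letter_in_lists[of a n] Cons.prems(1) by auto
  moreover have "rewrite (p \<circ> gen_perm a) w \<in> lists (fuse_gens n)"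
    using Cons by (intro Cons.IH permutes_compose gen_perm_permutes) auto
  ultimately show ?case by simp
qed simp

lemma gen_factorization:
  assumes "a \<in> vsb_gens n"
  shows "vsb_class n [a] = vsb_class n (fuse_word (gen_letter a) @ [Virt (gen_index a)])"
proof (cases a)
  case (SigInv i)
  then have i: "i \<in> {1..<n}" using assms by simp
  have "vsb_class n [SigInv i] = vsb_class n ([Virt i, Virt i] @ [SigInv i])"
    using virt_sq_context[OF i, of "[]" "[SigInv i]"] by simp
  also have "\<dots> = vsb_class n ([Virt i, Virt i, SigInv i] @ [Virt i, Virt i])"
    using virt_sq_context[OF i, of "[Virt i, Virt i, SigInv i]" "[]"] by simp
  finally show ?thesis using SigInv
    by (simp add: strand_def detour_adjacent virt_conj_def mu_inv_word_def)
qed (use assms virt_sq_context[of "gen_index a" n "[a]" "[]"] in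
  \<open>simp_all add: strand_def detour_adjacent mu_word_def gamma_word_def\<close>)

lemma rewrite_normal_form:
  assumes "w \<in> lists (vsb_gens n)" "s \<in> lists {1..<n}"
  shows "vsb_class n (map Virt s @ w) =
    vsb_class n (fuse_word (rewrite (word_perm (map Virt s)) w) @ map Virt (s @ map gen_index w))"
  using assms
proof (induction arbitrary: s rule: lists.induct)
  case Nil
  then show ?case by simp
next
  case (Cons a w)
  (* The generator a becomes a fusing string and v_i; the string passes to the left of s, while
     v_i joins s, which is why s has to be arbitrary in the induction. *)
  let ?p = "word_perm (map Virt s)" and ?i = "gen_index a"
  let ?e = "fuse_word (map (relabel ?p) (gen_letter a))"
  note a = Cons.hyps(1)
  have index: "s @ [?i] \<in> lists {1..<n}" using Cons.prems gen_index_in[OF a] by simp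
  have perm: "word_perm (map Virt (s @ [?i])) = ?p \<circ> gen_perm a"
    using word_perm_gen_index[of a] by (simp add: word_perm_append)
  have "vsb_class n (map Virt s @ a # w) = vsb_class n (map Virt s @ [a] @ w)" by simp
  also have "\<dots> = vsb_class n (map Virt s @ (fuse_word (gen_letter a) @ [Virt ?i]) @ w)"
    by (intro vsb_class_context gen_factorization a)
  also have "\<dots> = vsb_class n ([] @ (map Virt s @ fuse_word (gen_letter a)) @ Virt ?i # w)"
    by simp
  also have "\<dots> = vsb_class n ([] @ (?e @ map Virt s) @ Virt ?i # w)"
    by (intro vsb_class_context virt_word_fuse_word gen_letter_in_lists Cons.prems a)
  also have "\<dots> = vsb_class n (?e @ (map Virt (s @ [?i]) @ w) @ [])" by simp
  also have "\<dots> = vsb_class n (?e @ (fuse_word (rewrite (?p \<circ> gen_perm a) w) @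
      map Virt ((s @ [?i]) @ map gen_index w)) @ [])"
    unfolding perm[symmetric] by (intro vsb_class_context Cons.IH index)
  finally show ?case by simp
qed

lemma word_perm_gen_index_word: "word_perm (map Virt (map gen_index w)) = word_perm w"
  using word_perm_gen_index by (induction w) auto

lemma gen_index_word_in: "w \<in> lists (vsb_gens n) \<Longrightarrow> map gen_index w \<in> lists {1..<n}"
  using gen_index_in by (induction w) auto

text \<open>Both sides of an equation have the same permutation, so the transversal parts of their normal forms
  agree and can be cancelled.\<close>

lemma rewrite_respects_vsb_class:
  assumes "vsb_class n u = vsb_class n w" "u \<in> lists (vsb_gens n)" "s \<in> lists {1..<n}"
  defines "p \<equiv> word_perm (map Virt s)"
  shows "vsb_class n (fuse_word (rewrite p u)) = vsb_class n (fuse_word (rewrite p w))"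
proof -
  have w: "w \<in> lists (vsb_gens n)" using vsb_class_eqD[OF assms(1,2)] .
  let ?x = "s @ map gen_index u" and ?y = "s @ map gen_index w"
  have xy: "?x \<in> lists {1..<n}" "?y \<in> lists {1..<n}"
    using gen_index_word_in[OF assms(2)] gen_index_word_in[OF w] assms(3) by auto
  have "word_perm (map Virt ?x) = word_perm (map Virt ?y)"
    using word_perm_cong[OF assms(1,2)] word_perm_gen_index_word[of u] word_perm_gen_index_word[of w]
    by (simp add: word_perm_append)
  then have virt: "vsb_class n (map Virt ?x) = vsb_class n (map Virt ?y)"
    by (rule virt_word_eq[OF xy])
  have "vsb_class n (fuse_word (rewrite p u) @ map Virt ?x) = vsb_class n (map Virt s @ u)"
    unfolding p_def by (rule rewrite_normal_form[symmetric]) fact+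
  also have "\<dots> = vsb_class n (map Virt s @ w)"
    by (intro vsb_class_append_cong assms(1) HOL.refl)
  also have "\<dots> = vsb_class n (fuse_word (rewrite p w) @ map Virt ?y)"
    unfolding p_def by (rule rewrite_normal_form) fact+
  also have "\<dots> = vsb_class n (fuse_word (rewrite p w) @ map Virt ?x)"
    by (intro vsb_class_append_cong virt[symmetric] HOL.refl)
  finally show ?thesis by (rule virt_right_cancel) (rule xy)
qed


section \<open>The fusing relations hold in the braid monoid\<close>

lemma virt_word_transposition:
  assumes "x \<in> {1..n}" "y \<in> {1..n}"
  shows "\<exists>t \<in> lists {1..<n}. word_perm (map Virt t) = transpose x y"
proof -
  have upward: "\<exists>t \<in> lists {1..<n}. word_perm (map Virt t) = transpose x y"
    if "1 \<le> x" "x \<le> y" "y \<le> n" for x y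
    using that(2,3)
  proof (induction y rule: dec_induct)
    case base
    show ?case by (intro bexI[of _ "[]"]) auto
  next
    case (step y)
    then obtain t where t: "t \<in> lists {1..<n}" "word_perm (map Virt t) = transpose x y" by auto
    show ?case
    proof (cases "x = y")
      case True
      then show ?thesis using step that(1) by (intro bexI[of _ "[y]"]) auto
    next
      case False
      with step(1) have "transpose y (Suc y) \<circ> transpose x y \<circ> transpose y (Suc y) =
          transpose x (Suc y)"
        by (auto simp: fun_eq_iff transpose_def)
      then have "word_perm (map Virt (y # t @ [y])) = transpose x (Suc y)"
        using t(2) by (simp add: word_perm_append o_assoc)
      moreover have "y # t @ [y] \<in> lists {1..<n}" using t(1) step that(1) by auto
      ultimately show ?thesis by blast
    qed
  qed
  show ?thesis
  proof (cases "x \<le> y")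
    case True
    then show ?thesis using upward assms by simp
  next
    case False
    then show ?thesis using upward[of y x] assms by (simp add: transpose_commute)
  qed
qed

lemma distinct_length_le:
  assumes "distinct xs" "set xs \<subseteq> {1..n}"
  shows "length xs \<le> n"
  using card_mono[OF _ assms(2)] distinct_card[OF assms(1)] by simp

text \<open>Adjust one value at a time: a transposition moves the image of the next index to the wanted place
  without touching the values already fixed.\<close>

lemma virt_word_prescribed_values:
  assumes "distinct xs" "set xs \<subseteq> {1..n}"
  shows "\<exists>s \<in> lists {1..<n}. \<forall>i < length xs. word_perm (map Virt s) (Suc i) = xs ! i"
  using assms
proof (induction xs rule: rev_induct)
  case Nil
  show ?case by (intro bexI[of _ "[]"]) auto
next
  case (snoc x xs)
  then obtain s where s: "s \<in> lists {1..<n}"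
    and vals: "\<forall>i < length xs. word_perm (map Virt s) (Suc i) = xs ! i" by auto
  let ?p = "word_perm (map Virt s)" and ?m = "length xs"
  let ?y = "?p (Suc ?m)"
  have p: "?p permutes {1..n}"
    using s by (intro word_perm_permutes) (simp only: map_Virt_in_lists)
  have "length (xs @ [x]) \<le> n"
    by (rule distinct_length_le) (rule snoc.prems)+
  then have "?y \<in> {1..n}" using permutes_in_image[OF p] by simp
  moreover have "x \<in> {1..n}" using snoc.prems(2) by simp
  ultimately obtain t where t: "t \<in> lists {1..<n}" "word_perm (map Virt t) = transpose ?y x"
    using virt_word_transposition by blast
  have "word_perm (map Virt (t @ s)) (Suc i) = (xs @ [x]) ! i" if "i < length (xs @ [x])" for i
  proof (cases "i < ?m")
    case True
    have "xs ! i \<noteq> x" using snoc.prems(1) True nth_mem by fastforce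
    moreover have "?p (Suc i) \<noteq> ?y" using True permutes_apply_eq_iff[OF p] by simp
    ultimately show ?thesis
      using True vals t(2) by (simp add: word_perm_append nth_append transpose_def)
  next
    case False
    then have "i = ?m" using that by simp
    then show ?thesis using t(2) by (simp add: word_perm_append)
  qed
  moreover have "t @ s \<in> lists {1..<n}" using s t(1) by auto
  ultimately show ?case by blast
qed

text \<open>Transfers one braid relation between small indices to arbitrary distinct indices xs: some word s in
  the \<open>v\<^sub>i\<close> has a permutation p that sends 1, 2, ... to xs, and rewriting the relation behind s
  yields the relation between fusing strings with indices in xs.\<close>

lemma fuse_relation_by_rewriting:
  assumes "distinct xs" "set xs \<subseteq> {1..n}"
    and "length xs \<le> n \<Longrightarrow> (a, b) \<in> vsb_rels n"
    and "length xs \<le> n \<Longrightarrow> a \<in> lists (vsb_gens n)"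
    and "\<And>p. \<forall>i < length xs. p (Suc i) = xs ! i \<Longrightarrow> rewrite p a = u \<and> rewrite p b = v"
  shows "vsb_class n (fuse_word u) = vsb_class n (fuse_word v)"
proof -
  obtain s where s: "s \<in> lists {1..<n}"
    "\<forall>i < length xs. word_perm (map Virt s) (Suc i) = xs ! i"
    using virt_word_prescribed_values[OF assms(1,2)] by blast
  have "length xs \<le> n" by (rule distinct_length_le) (rule assms)+
  then have "vsb_class n (fuse_word (rewrite (word_perm (map Virt s)) a)) =
      vsb_class n (fuse_word (rewrite (word_perm (map Virt s)) b))"
    using assms(3,4) s(1) by (intro rewrite_respects_vsb_class vsb_class_relation)
  then show ?thesis using assms(5)[OF s(2)] by simp
qed

lemma fuse_relation_holds:
  assumes "(u, v) \<in> fuse_rels n"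
  shows "vsb_class n (fuse_word u) = vsb_class n (fuse_word v)"
proof -
  note eval = All_less_Suc eval_nat_numeral transpose_def
  have R1: "vsb_class n (fuse_word [Mu k l, MuInv k l]) = vsb_class n (fuse_word [])"
    and R2: "vsb_class n (fuse_word [MuInv l k, Mu l k]) = vsb_class n (fuse_word [])"
    and R6: "vsb_class n (fuse_word [Mu k l, Gam l k]) = vsb_class n (fuse_word [Gam k l, Mu l k])"
    if "{k, l} \<subseteq> {1..n}" "distinct [k, l]" for k l
  proof -
    note lift = fuse_relation_by_rewriting[of "[k, l]"]
    show "vsb_class n (fuse_word [Mu k l, MuInv k l]) = vsb_class n (fuse_word [])"
      by (rule lift[of n "[Sig 1, SigInv 1]" "[]"])
         (use that in \<open>auto simp: vsb_rels_def eval\<close>)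
    show "vsb_class n (fuse_word [MuInv l k, Mu l k]) = vsb_class n (fuse_word [])"
      by (rule lift[of n "[SigInv 1, Sig 1]" "[]"])
         (use that in \<open>auto simp: vsb_rels_def eval\<close>)
    show "vsb_class n (fuse_word [Mu k l, Gam l k]) = vsb_class n (fuse_word [Gam k l, Mu l k])"
      by (rule lift[of n "[Sig 1, Tau 1]" "[Tau 1, Sig 1]"])
         (use that in \<open>auto simp: vsb_rels_def eval\<close>)
  qed
  have R3: "vsb_class n (fuse_word [Mu i j, Mu i k, Mu j k]) =
      vsb_class n (fuse_word [Mu j k, Mu i k, Mu i j])"
    and R4: "vsb_class n (fuse_word [Mu i j, Mu i k, Gam j k]) =
      vsb_class n (fuse_word [Gam j k, Mu i k, Mu i j])"
    and R5: "vsb_class n (fuse_word [Gam i j, Mu i k, Mu j k]) =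
      vsb_class n (fuse_word [Mu j k, Mu i k, Gam i j])"
    if "{i, j, k} \<subseteq> {1..n}" "distinct [i, j, k]" for i j k
  proof -
    note lift = fuse_relation_by_rewriting[of "[i, j, k]"]
    show "vsb_class n (fuse_word [Mu i j, Mu i k, Mu j k]) =
        vsb_class n (fuse_word [Mu j k, Mu i k, Mu i j])"
      by (rule lift[of n "[Sig 1, Sig 2, Sig 1]" "[Sig 2, Sig 1, Sig 2]"])
         (use that in \<open>auto simp: vsb_rels_def eval\<close>)
    show "vsb_class n (fuse_word [Mu i j, Mu i k, Gam j k]) =
        vsb_class n (fuse_word [Gam j k, Mu i k, Mu i j])"
      by (rule lift[of n "[Sig 1, Sig 2, Tau 1]" "[Tau 2, Sig 1, Sig 2]"])
         (use that in \<open>auto simp: vsb_rels_def eval\<close>)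
    show "vsb_class n (fuse_word [Gam i j, Mu i k, Mu j k]) =
        vsb_class n (fuse_word [Mu j k, Mu i k, Gam i j])"
      (* the mixed relation as before, but with j = i - 1 instead of j = i + 1 *)
      by (rule lift[of n "[Sig 2, Sig 1, Tau 2]" "[Tau 1, Sig 2, Sig 1]", symmetric])
         (use that in \<open>auto simp: vsb_rels_def eval\<close>)
  qed
  have R7: "vsb_class n (fuse_word [Mu i j, Mu k l]) = vsb_class n (fuse_word [Mu k l, Mu i j])"
    and R8: "vsb_class n (fuse_word [Gam i j, Gam k l]) = vsb_class n (fuse_word [Gam k l, Gam i j])"
    and R9: "vsb_class n (fuse_word [Mu i j, Gam k l]) = vsb_class n (fuse_word [Gam k l, Mu i j])"
    if "{i, j, k, l} \<subseteq> {1..n}" "distinct [i, j, k, l]" for i j k l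
  proof -
    note lift = fuse_relation_by_rewriting[of "[i, j, k, l]"]
    show "vsb_class n (fuse_word [Mu i j, Mu k l]) = vsb_class n (fuse_word [Mu k l, Mu i j])"
      by (rule lift[of n "[Sig 1, Sig 3]" "[Sig 3, Sig 1]"])
         (use that in \<open>auto intro: vsb_far_relation simp: eval\<close>)
    show "vsb_class n (fuse_word [Gam i j, Gam k l]) = vsb_class n (fuse_word [Gam k l, Gam i j])"
      by (rule lift[of n "[Tau 1, Tau 3]" "[Tau 3, Tau 1]"])
         (use that in \<open>auto intro: vsb_far_relation simp: eval\<close>)
    show "vsb_class n (fuse_word [Mu i j, Gam k l]) = vsb_class n (fuse_word [Gam k l, Mu i j])"
      by (rule lift[of n "[Sig 1, Tau 3]" "[Tau 3, Sig 1]"])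
         (use that in \<open>auto intro: vsb_far_relation simp: eval\<close>)
  qed
  from assms show ?thesis
    unfolding fuse_rels_def
    by (elim UnE CollectE exE conjE; unfold prod.inject; elim conjE; hypsubst)
       (intro R1 R2 R3 R4 R5 R6 R7 R8 R9; simp)+
qed


section \<open>The braid relations hold for fusing strings\<close>

text \<open>The indices of the letters in \<open>rewrite p u\<close> are images under p of distinct numbers, so each braid
  relation becomes an instance of one fusing relation. The involution, braid and
  conjugation relations of the \<open>v\<^sub>i\<close> become equalities of words.\<close>

lemma rewrite_respects_relation:
  assumes "(u, w) \<in> vsb_rels n" and p: "p permutes {1..n}"
  shows "fuse_class n (rewrite p u) = fuse_class n (rewrite p w)"
proof -
  note inj = permutes_apply_eq_iff[OF p]
  have mem: "1 \<le> p i \<and> p i \<le> n \<longleftrightarrow> 1 \<le> i \<and> i \<le> n" for i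
    using permutes_in_image[OF p, of i] by simp
  note eval = transpose_def inj mem[simplified] fuse_rels_def
  have R1: "fuse_class n (rewrite p [Sig i, SigInv i]) = fuse_class n (rewrite p [])"
    and R2: "fuse_class n (rewrite p [SigInv i, Sig i]) = fuse_class n (rewrite p [])"
    and R8: "fuse_class n (rewrite p [Sig i, Tau i]) = fuse_class n (rewrite p [Tau i, Sig i])"
    if "i \<in> {1..<n}" for i
    by (rule fuse_class_relation; use that in \<open>simp add: eval\<close>)+
  have R3: "fuse_class n (rewrite p [Sig i, Sig (Suc i), Sig i]) =
      fuse_class n (rewrite p [Sig (Suc i), Sig i, Sig (Suc i)])"
    and R7: "fuse_class n (rewrite p [Sig i, Sig (Suc i), Tau i]) =
      fuse_class n (rewrite p [Tau (Suc i), Sig i, Sig (Suc i)])"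
    and R7': "fuse_class n (rewrite p [Tau i, Sig (Suc i), Sig i]) =
      fuse_class n (rewrite p [Sig (Suc i), Sig i, Tau (Suc i)])"
    if "i \<in> {1..<n}" "Suc i \<in> {1..<n}" for i
    by (rule fuse_class_relation; use that in \<open>simp add: eval\<close>)+
  have commute: "fuse_class n (rewrite p [g i, h j]) = fuse_class n (rewrite p [h j, g i])"
    if "g \<in> {Sig, Tau, Virt}" "h \<in> {Sig, Tau, Virt}" "i \<in> {1..<n}" "j \<in> {1..<n}"
      "\<bar>int i - int j\<bar> > 1" for g h i j
  proof -
    have far: "i \<noteq> j" "Suc i \<noteq> j" "i \<noteq> Suc j" using that(5) by auto
    have SS: "fuse_class n (rewrite p [Sig i, Sig j]) = fuse_class n (rewrite p [Sig j, Sig i])"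
      and TT: "fuse_class n (rewrite p [Tau i, Tau j]) = fuse_class n (rewrite p [Tau j, Tau i])"
      and ST: "fuse_class n (rewrite p [Sig i, Tau j]) = fuse_class n (rewrite p [Tau j, Sig i])"
      and TS: "fuse_class n (rewrite p [Sig j, Tau i]) = fuse_class n (rewrite p [Tau i, Sig j])"
      by (rule fuse_class_relation; use that(3,4) far in \<open>simp add: eval\<close>)+
    have virt: "rewrite p [Virt i, Sig j] = rewrite p [Sig j, Virt i]"
      "rewrite p [Virt i, Tau j] = rewrite p [Tau j, Virt i]"
      "rewrite p [Virt i, Virt j] = rewrite p [Virt j, Virt i]"
      "rewrite p [Sig i, Virt j] = rewrite p [Virt j, Sig i]"
      "rewrite p [Tau i, Virt j] = rewrite p [Virt j, Tau i]"
      using far by (auto simp: transpose_def)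
    show ?thesis using that(1,2)
      by (elim insertE emptyE; simp only: SS TT ST TS virt)
  qed
  have adjacent: "j = Suc i \<or> i = Suc j" if "\<bar>int i - int j\<bar> = 1" for i j
    using that by linarith
  from assms(1) show ?thesis
    unfolding vsb_rels_def
  proof (elim UnE CollectE exE conjE, goal_cases)
    case (1 i)
    then show ?case using R1 by (simp del: rewrite.simps)
  next
    case (2 i)
    then show ?case using R2 by (simp del: rewrite.simps)
  next
    case (3 i)
    then show ?case by simp
  next
    case (4 i j)
    then show ?case using adjacent[of i j] R3[of i] R3[of j] by (auto simp del: rewrite.simps)
  next
    case (5 i j)
    then show ?case by simp
  next
    case (6 i j)
    then show ?case using adjacent[of i j] by (auto simp: transpose_def)
  next
    case (7 i j)
    then show ?case using adjacent[of i j] by (auto simp: transpose_def)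
  next
    case (8 i j)
    then show ?case using adjacent[of i j] R7[of i] R7'[of j] by (auto simp del: rewrite.simps)
  next
    case (9 i)
    then show ?case using R8 by (simp del: rewrite.simps)
  next
    case (10 g h i j)
    then show ?case using commute[of g h i j] by (simp del: rewrite.simps)
  qed
qed

lemma rewrite_respects_word_cong:
  assumes "(u, w) \<in> word_cong (vsb_gens n) (vsb_rels n)" "p permutes {1..n}"
  shows "fuse_class n (rewrite p u) = fuse_class n (rewrite p w)"
  using assms
proof (induction arbitrary: p rule: word_cong.induct)
  case (base u v x y)
  have x: "p \<circ> word_perm x permutes {1..n}"
    using base by (intro permutes_compose word_perm_permutes)
  have perm: "word_perm u = word_perm v"
    using base by (intro word_perm_cong vsb_class_relation)
  show ?case unfolding rewrite_append perm
    by (intro fuse_class_append_cong rewrite_respects_relation base(1) x HOL.refl)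
qed simp_all

lemma word_perm_detour: "word_perm c = id \<Longrightarrow> word_perm (detour i j c) = id"
proof (induction j)
  case (Suc j)
  show ?case
  proof (cases "i < j")
    case True
    then show ?thesis using Suc by (simp add: detour_Suc virt_conj_def word_perm_append o_assoc)
  next
    case False
    then show ?thesis using Suc.prems by (simp add: detour_def)
  qed
qed (simp add: detour_def)

lemma word_perm_strand:
  assumes "\<And>i. word_perm (b i) = id"
  shows "word_perm (strand b k l) = id"
  unfolding strand_def using assms
  by (auto simp: virt_conj_def word_perm_append intro!: word_perm_detour)

lemma word_perm_letter_word: "word_perm (letter_word x) = id"
  by (cases x)
     (auto intro!: word_perm_strand simp: mu_word_def mu_inv_word_def gamma_word_def)

lemma word_perm_fuse_word: "word_perm (fuse_word u) = id"
  by (induction u) (auto simp: word_perm_append word_perm_letter_word)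

lemma rewrite_virt_word: "rewrite p (map Virt s) = []"
  by (induction s arbitrary: p) auto

lemma word_perm_descent:
  "i < j \<Longrightarrow> word_perm (map Virt (rev [Suc i..<j])) i = i \<and>
    word_perm (map Virt (rev [Suc i..<j])) (Suc i) = j"
proof (induction j)
  case (Suc j)
  then show ?case by (cases "i = j") (auto simp: transpose_def)
qed simp

lemma rewrite_detour:
  "rewrite id (detour i j c) = rewrite (word_perm (map Virt (rev [i+1..<j]))) c"
  unfolding detour_def by (simp add: rewrite_append rewrite_virt_word)

text \<open>The leading \<open>v\<^bsub>l-1\<^esub> \<dots> v\<^bsub>k+1\<^esub>\<close> of the string contribute no letters, but their permutation
  fixes k and sends k + 1 to l; hence the core \<open>\<sigma>\<^sub>k v\<^sub>k\<close> is recorded with the indices k and l.\<close>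

lemma rewrite_letter_word:
  assumes "x \<in> fuse_gens n"
  shows "rewrite id (letter_word x) = [x]"
proof -
  have "rewrite id (strand b k l) = (if k < l
      then rewrite (word_perm (map Virt (rev [k+1..<l]))) (b k)
      else rewrite (word_perm (map Virt (rev [l+1..<k])) \<circ> transpose l (Suc l)) (b l))"
    if "k \<noteq> l" for b k l
    by (simp add: strand_def virt_conj_def rewrite_detour rewrite_append)
  then show ?thesis
    using assms word_perm_descent
    by (cases x) (auto simp: mu_word_def mu_inv_word_def gamma_word_def)
qed

lemma rewrite_fuse_word: "u \<in> lists (fuse_gens n) \<Longrightarrow> rewrite id (fuse_word u) = u"
  by (induction u) (auto simp: rewrite_append rewrite_letter_word word_perm_letter_word)


section \<open>The presentation\<close>

lemma vsb_class_mult: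
  "u \<in> lists (vsb_gens n) \<Longrightarrow> w \<in> lists (vsb_gens n) \<Longrightarrow>
    vsb_class n u \<otimes>\<^bsub>VSB n\<^esub> vsb_class n w = vsb_class n (u @ w)"
  unfolding vsb_class_def VSB_def by (rule mult_word_class)

lemma vsb_class_in_carrier: "w \<in> lists (vsb_gens n) \<Longrightarrow> vsb_class n w \<in> carrier (VSB n)"
  unfolding vsb_class_def VSB_def carrier_presented_monoid by blast

lemma one_VSB: "\<one>\<^bsub>VSB n\<^esub> = vsb_class n []"
  unfolding vsb_class_def VSB_def by (rule one_presented_monoid)

lemma monoid_VSB: "monoid (VSB n)"
  unfolding VSB_def by (rule monoid_presented_monoid)

lemma carrier_VSP:
  "carrier (VSP n) = {vsb_class n w | w. w \<in> lists (vsb_gens n) \<and> word_perm w = id}"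
proof -
  have "carrier (VSB n) = vsb_class n ` lists (vsb_gens n)"
    unfolding VSB_def carrier_presented_monoid vsb_class_def ..
  then show ?thesis
    by (auto simp: VSP_def kernel_def sym_group_one vsb_perm_class[unfolded in_lists_conv_set])
qed

lemma monoid_VSP: "monoid (VSP n)"
proof -
  interpret monoid "VSB n" by (rule monoid_VSB)
  have ops: "mult (VSP n) = mult (VSB n)" "one (VSP n) = one (VSB n)" by (simp_all add: VSP_def)
  have sub: "carrier (VSP n) \<subseteq> carrier (VSB n)" by (auto simp: VSP_def kernel_def)
  have closed: "X \<otimes>\<^bsub>VSB n\<^esub> Y \<in> carrier (VSP n)"
    if "X \<in> carrier (VSP n)" "Y \<in> carrier (VSP n)" for X Y
  proof -
    obtain u w where uw: "u \<in> lists (vsb_gens n)" "w \<in> lists (vsb_gens n)"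
      "X = vsb_class n u" "Y = vsb_class n w" "word_perm u = id" "word_perm w = id"
      using \<open>X \<in> carrier (VSP n)\<close> \<open>Y \<in> carrier (VSP n)\<close> unfolding carrier_VSP by blast
    have "X \<otimes>\<^bsub>VSB n\<^esub> Y = vsb_class n (u @ w)" using uw vsb_class_mult by simp
    moreover have "word_perm (u @ w) = id" using uw by (simp add: word_perm_append)
    moreover have "u @ w \<in> lists (vsb_gens n)" using uw by simp
    ultimately show ?thesis unfolding carrier_VSP by blast
  qed
  have one: "\<one>\<^bsub>VSB n\<^esub> \<in> carrier (VSP n)"
    unfolding carrier_VSP one_VSB by (auto intro: exI[of _ "[]"])
  show ?thesis
    by (rule monoidI; unfold ops) (use closed one sub m_assoc in \<open>auto simp: subset_iff\<close>)
qed

text \<open>For \<open>\<mu>\<^bsub>kl\<^esub>\<^sup>-\<^sup>1\<close>, an inverse in the monoid by definition, the first two fusing relations identify it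
  with the class of an explicit word.\<close>

lemma fuse_elem_eq:
  assumes "x \<in> fuse_gens n"
  shows "fuse_elem n x = vsb_class n (letter_word x)"
proof -
  interpret monoid "VSB n" by (rule monoid_VSB)
  have mu: "mu n k l = vsb_class n (strand mu_word k l)" for k l
    by (simp add: mu_def strand_def virt_conj_def)
  have gamma: "gamma n k l = vsb_class n (strand gamma_word k l)" for k l
    by (simp add: gamma_def strand_def virt_conj_def)
  show ?thesis
  proof (cases x)
    case (MuInv k l)
    then have gens: "Mu k l \<in> fuse_gens n" "MuInv k l \<in> fuse_gens n" using assms by auto
    let ?m = "letter_word (Mu k l)" and ?i = "letter_word (MuInv k l)"
    have words: "?m \<in> lists (vsb_gens n)" "?i \<in> lists (vsb_gens n)"
      using gens letter_word_in_lists by blast+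
    have "vsb_class n (fuse_word [Mu k l, MuInv k l]) = vsb_class n (fuse_word [])"
      "vsb_class n (fuse_word [MuInv k l, Mu k l]) = vsb_class n (fuse_word [])"
      by (rule fuse_relation_holds; use gens(1) in \<open>simp add: fuse_rels_def\<close>)+
    then have "inv\<^bsub>VSB n\<^esub> vsb_class n ?m = vsb_class n ?i"
      by (intro inv_unique'[symmetric])
         (use words in
          \<open>simp_all add: vsb_class_mult vsb_class_in_carrier one_VSB del: letter_word.simps\<close>)
    then show ?thesis using MuInv by (simp add: mu)
  qed (simp_all add: mu gamma)
qed

lemma word_val_fuse_elem:
  assumes "u \<in> lists (fuse_gens n)"
  shows "word_val (VSB n) (fuse_elem n) u = vsb_class n (fuse_word u)"
  using assms
proof (induction rule: lists.induct)
  case Nil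
  then show ?case by (simp add: word_val_def one_VSB)
next
  case (Cons x u)
  have "word_val (VSB n) (fuse_elem n) (x # u) =
      fuse_elem n x \<otimes>\<^bsub>VSB n\<^esub> word_val (VSB n) (fuse_elem n) u"
    by (simp add: word_val_def)
  also have "\<dots> = vsb_class n (letter_word x @ fuse_word u)"
    unfolding Cons.IH fuse_elem_eq[OF Cons.hyps(1)]
    by (intro vsb_class_mult letter_word_in_lists fuse_word_in_lists Cons.hyps)
  finally show ?case by simp
qed

text \<open>Rewriting carries a chain of braid relations between the spelled-out words to a chain of fusing
  relations between u and v themselves.\<close>

lemma fuse_word_class_injective:
  assumes "u \<in> lists (fuse_gens n)" "v \<in> lists (fuse_gens n)"
    and "vsb_class n (fuse_word u) = vsb_class n (fuse_word v)"
  shows "fuse_class n u = fuse_class n v"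
proof -
  have "(fuse_word u, fuse_word v) \<in> word_cong (vsb_gens n) (vsb_rels n)"
    using assms(3) fuse_word_in_lists[OF assms(1)] fuse_word_in_lists[OF assms(2)]
    by (simp add: vsb_class_def word_class_eq_iff)
  from rewrite_respects_word_cong[OF this permutes_id] show ?thesis
    unfolding rewrite_fuse_word[OF assms(1)] rewrite_fuse_word[OF assms(2)] .
qed

lemma pure_word_is_fuse_word:
  assumes "w \<in> lists (vsb_gens n)" "word_perm w = id"
  shows "vsb_class n w = vsb_class n (fuse_word (rewrite id w))"
proof -
  have index: "map gen_index w \<in> lists {1..<n}" by (rule gen_index_word_in) fact
  have perm: "word_perm (map Virt (map gen_index w)) = word_perm (map Virt [])"
    unfolding word_perm_gen_index_word using assms(2) by simp
  have "vsb_class n (map Virt (map gen_index w)) = vsb_class n (map Virt [])"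
    by (rule virt_word_eq[OF index _ perm]) simp
  then have trivial: "vsb_class n (map Virt (map gen_index w)) = vsb_class n []" by simp
  have "vsb_class n (map Virt [] @ w) =
      vsb_class n (fuse_word (rewrite (word_perm (map Virt [])) w) @ map Virt ([] @ map gen_index w))"
    by (rule rewrite_normal_form) (use assms(1) in auto)
  also have "\<dots> = vsb_class n (fuse_word (rewrite id w) @ [])"
    unfolding append_Nil list.map(1) word_perm.simps(1)
    by (intro vsb_class_append_cong trivial HOL.refl)
  finally show ?thesis by simp
qed

theorem theorem17:
  fixes n :: nat
  assumes "n \<ge> 2"
  shows "has_presentation (VSP n) (fuse_gens n) (fuse_elem n) (fuse_rels n)"
proof -
  interpret monoid "VSB n" by (rule monoid_VSB)
  let ?P = "presented_monoid (fuse_gens n) (fuse_rels n)"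
  let ?\<phi> = "induced_map (VSB n) (fuse_elem n)"
  have images: "fuse_elem n \<in> fuse_gens n \<rightarrow> carrier (VSB n)"
    by (intro Pi_I) (simp only: fuse_elem_eq letter_word_in_lists vsb_class_in_carrier)
  have relations: "\<forall>(u, v)\<in>fuse_rels n.
      word_val (VSB n) (fuse_elem n) u = word_val (VSB n) (fuse_elem n) v"
  proof clarify
    fix u v assume uv: "(u, v) \<in> fuse_rels n"
    then have "u \<in> lists (fuse_gens n)" "v \<in> lists (fuse_gens n)"
      by (auto simp: fuse_rels_def)
    then show "word_val (VSB n) (fuse_elem n) u = word_val (VSB n) (fuse_elem n) v"
      using fuse_relation_holds[OF uv] by (simp only: word_val_fuse_elem)
  qed
  note hom = induced_hom[OF images relations]
  have carrier: "carrier ?P = fuse_class n ` lists (fuse_gens n)"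
    unfolding carrier_presented_monoid fuse_class_def ..
  have \<phi>: "?\<phi> (fuse_class n u) = vsb_class n (fuse_word u)" if "u \<in> lists (fuse_gens n)" for u
    unfolding fuse_class_def induced_map_class[OF images relations that]
    by (rule word_val_fuse_elem) (rule that)
  have image: "?\<phi> ` carrier ?P = carrier (VSP n)"
  proof
    show "?\<phi> ` carrier ?P \<subseteq> carrier (VSP n)"
    proof
      fix X assume "X \<in> ?\<phi> ` carrier ?P"
      then obtain u where "u \<in> lists (fuse_gens n)" "X = vsb_class n (fuse_word u)"
        unfolding carrier using \<phi> by blast
      then show "X \<in> carrier (VSP n)"
        unfolding carrier_VSP using fuse_word_in_lists word_perm_fuse_word by blast
    qed
    show "carrier (VSP n) \<subseteq> ?\<phi> ` carrier ?P"
    proof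
      fix X assume "X \<in> carrier (VSP n)"
      then obtain w where w: "w \<in> lists (vsb_gens n)" "word_perm w = id" "X = vsb_class n w"
        unfolding carrier_VSP by blast
      have "rewrite id w \<in> lists (fuse_gens n)"
        by (rule rewrite_in_lists[OF w(1) permutes_id])
      moreover from this have "?\<phi> (fuse_class n (rewrite id w)) = X"
        using \<phi> pure_word_is_fuse_word[OF w(1,2)] w(3) by simp
      ultimately show "X \<in> ?\<phi> ` carrier ?P" unfolding carrier by blast
    qed
  qed
  have "inj_on ?\<phi> (carrier ?P)"
  proof (rule inj_onI)
    fix X Y assume "X \<in> carrier ?P" "Y \<in> carrier ?P" and eq: "?\<phi> X = ?\<phi> Y"
    then obtain u v where uv: "u \<in> lists (fuse_gens n)" "v \<in> lists (fuse_gens n)"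
      "X = fuse_class n u" "Y = fuse_class n v" unfolding carrier by blast
    with eq have "vsb_class n (fuse_word u) = vsb_class n (fuse_word v)" by (simp only: \<phi>)
    then show "X = Y" unfolding uv(3,4) by (rule fuse_word_class_injective[OF uv(1,2)])
  qed
  moreover have "?\<phi> \<in> hom ?P (VSP n)"
    using hom(1) image by (auto simp: hom_def VSP_def)
  ultimately have "?\<phi> \<in> iso ?P (VSP n)"
    unfolding iso_def bij_betw_def using image by blast
  then show ?thesis
    unfolding has_presentation_def using monoid_VSP hom(2) by blast
qed

end
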